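(* Let $\mu,\nu\in\mathbb{C}$ with $-1<\Re(\mu)<\Re\big(2\nu-\tfrac12\big)$ and $\Re(\nu)>0$, let $z>0$, and let $f$ be a complex-valued measurable function on $(0,\infty)$ such that the integrals involved in the identities below converge absolutely. Then $$\mathcal{L}_{2}\bigg\{y^{2\mu-2\nu}\,\mathcal{L}_{2}\Big\{f(x);\frac{1}{2y}\Big\};z\bigg\}=\frac{z^{\nu-\mu-\frac{3}{2}}}{2^{\mu-\nu+1}}\,\mathcal{K}_{\nu-\mu-1}\big\{x^{\mu-\nu+\frac{3}{2}}\,f(x);z\big\},$$ $$\mathcal{L}_{2}\bigg\{y^{2\mu-2\nu}\,\mathcal{L}_{2}\Big\{f(x);\frac{1}{2y}\Big\};z\bigg\}=\frac{2^{2\nu-\mu-2}}{z^{\mu+\frac{1}{2}}}\,\Gamma(\nu)\,\mathcal{H}_{\mu}\Big\{u^{\mu+\frac{1}{2}}\,\mathcal{P}_{\nu,2}\big\{f(x);u\big\};z\Big\},$$ and $$\mathcal{H}_{\mu}\Big\{u^{\mu+\frac{1}{2}}\,\mathcal{P}_{\nu,2}\big\{f(x);u\big\};z\Big\}=\frac{1}{\Gamma(\nu)}\Big(\frac{z}{2}\Big)^{\nu-1}\mathcal{K}_{\nu-\mu-1}\Big\{x^{\mu-\nu+\frac{3}{2}}\,f(x);z\Big\}.$$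
   Context: For a function $f$ on $(0,\infty)$ and $y>0$, define $$\mathcal{L}_{2}\{f(x);y\}=\int_0^\infty x\,\exp(-x^{2}y^{2})\,f(x)\,dx,\qquad \mathcal{P}_{\nu,2}\{f(x);y\}=\int_{0}^{\infty}\frac{x\,f(x)}{(x^{2}+y^{2})^{\nu}}\,dx,$$ the Hankel transform $$\mathcal{H}_{\nu}\{f(x);y\}=\int_{0}^{\infty}\sqrt{xy}\,J_{\nu}(xy)\,f(x)\,dx,$$ and the $\mathcal{K}$-transform $$\mathcal{K}_{\nu}\{f(x);y\}=\int_{0}^{\infty}\sqrt{xy}\,K_{\nu}(xy)\,f(x)\,dx,$$ where $J_\nu$ is the Bessel function of the first kind of order $\nu$ and $K_\nu$ is the modified Bessel function of the second kind (Macdonald function) of order $\nu$. In the notation $T\{f(x);y\}$, the first entry is the function being transformed (of the indicated dummy variable) and $y$ is the argument of the transform; $\mathcal{L}_2\{f(x);\frac1{2y}\}$ is the $\mathcal{L}_2$-transform of $f$ evaluated at $1/(2y)$. Absolute convergence of an iterated integral means that it is finite when the fully written-out integrand is replaced by its absolute value. Powers of positive reals with complex exponent are principal. *)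

theory Defs
  imports "HOL-Analysis.Analysis"
begin

text \<open>
  Bessel functions of arbitrary complex order \<open>\<nu>\<close>, for arguments \<open>x > 0\<close> only
  (the prefactor \<open>(x/2) powr \<nu>\<close> has no meaning for \<open>x \<le> 0\<close>; in particular \<open>0 powr 0 = 0\<close>).
  The entire function \<^const>\<open>rGamma\<close> is \<open>1/\<Gamma>\<close>, so terms at poles of \<open>\<Gamma>\<close> vanish as they should.
\<close>

definition Bessel_J :: "complex \<Rightarrow> real \<Rightarrow> complex" where
  "Bessel_J \<nu> x =
     of_real (x / 2) powr \<nu> *
     (\<Sum>m. (-1) ^ m * rGamma (of_nat m + \<nu> + 1) / fact m * of_real (x / 2) ^ (2 * m))"

definition Bessel_I :: "complex \<Rightarrow> real \<Rightarrow> complex" where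
  "Bessel_I \<nu> x =
     of_real (x / 2) powr \<nu> *
     (\<Sum>m. rGamma (of_nat m + \<nu> + 1) / fact m * of_real (x / 2) ^ (2 * m))"

definition Bessel_K_nonint :: "complex \<Rightarrow> real \<Rightarrow> complex" where
  "Bessel_K_nonint \<nu> x =
     of_real pi / 2 * (Bessel_I (- \<nu>) x - Bessel_I \<nu> x) / sin (\<nu> * of_real pi)"

text \<open>At integer order the quotient is \<open>0/0\<close> and is replaced by its limit in the order.\<close>

definition Bessel_K :: "complex \<Rightarrow> real \<Rightarrow> complex" where
  "Bessel_K \<nu> x =
     (if \<nu> \<in> \<int> then Lim (at \<nu>) (\<lambda>w. Bessel_K_nonint w x) else Bessel_K_nonint \<nu> x)"

definition L2_transform :: "(real \<Rightarrow> complex) \<Rightarrow> real \<Rightarrow> complex" where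
  "L2_transform f y =
     (\<integral>x. of_real (x * exp (- (x\<^sup>2 * y\<^sup>2))) * f x \<partial>lebesgue_on {0<..})"

definition P2_transform :: "complex \<Rightarrow> (real \<Rightarrow> complex) \<Rightarrow> real \<Rightarrow> complex" where
  "P2_transform \<nu> f y =
     (\<integral>x. of_real x * f x / of_real (x\<^sup>2 + y\<^sup>2) powr \<nu> \<partial>lebesgue_on {0<..})"

definition Hankel_transform :: "complex \<Rightarrow> (real \<Rightarrow> complex) \<Rightarrow> real \<Rightarrow> complex" where
  "Hankel_transform \<nu> f y =
     (\<integral>x. of_real (sqrt (x * y)) * Bessel_J \<nu> (x * y) * f x \<partial>lebesgue_on {0<..})"

definition K_transform :: "complex \<Rightarrow> (real \<Rightarrow> complex) \<Rightarrow> real \<Rightarrow> complex" where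
  "K_transform \<nu> f y =
     (\<integral>x. of_real (sqrt (x * y)) * Bessel_K \<nu> (x * y) * f x \<partial>lebesgue_on {0<..})"

definition abs_convergent :: "(real \<Rightarrow> complex) \<Rightarrow> bool" where
  "abs_convergent g \<longleftrightarrow> (\<integral>\<^sup>+x. ennreal (norm (g x)) \<partial>lebesgue_on {0<..}) < \<infinity>"

text \<open>The first argument of the integrand is the outer variable of integration.\<close>

definition abs_convergent_iterated :: "(real \<Rightarrow> real \<Rightarrow> complex) \<Rightarrow> bool" where
  "abs_convergent_iterated g \<longleftrightarrow>
     (\<integral>\<^sup>+s. (\<integral>\<^sup>+x. ennreal (norm (g s x)) \<partial>lebesgue_on {0<..}) \<partial>lebesgue_on {0<..}) < \<infinity>"

end

theory Submission
  imports Defs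
begin

text \<open>
  Put \<open>w = \<nu> - \<mu> - 1\<close>. All three identities say that an iterated integral, once the order of
  integration is exchanged, becomes a multiple of the single integral
  \<open>\<integral>x. x powr (1 - w) * K\<^sub>w(x z) * f x\<close>; absolute convergence is exactly what Fubini needs. The whole
  content therefore lies in two inner integrals, and both reduce to the Macdonald integral
  \<open>G(s, c) = \<integral>t. t powr (s - 1) * exp (- t - c / t)\<close> over \<open>t > 0\<close>.

  For the iterated \<open>L\<^sub>2\<close>-transform the substitution \<open>t = (x/2)\<^sup>2 / y\<^sup>2\<close> turns the integral over \<open>y\<close>
  into \<open>G(w, (x z / 2)\<^sup>2)\<close> (\<open>integral_L2_L2_kernel\<close>). For the Hankel transform of the \<open>P\<close>-transform
  one writes \<open>\<Gamma>(\<nu>) / (x\<^sup>2 + u\<^sup>2) powr \<nu>\<close> as a Gamma integral in \<open>t\<close>, integrates the Bessel function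
  against the Gaussian \<open>exp (- t u\<^sup>2)\<close> term by term (\<open>integral_Bessel_J_Gaussian\<close>), and is left with
  \<open>G(w, (x z / 2)\<^sup>2)\<close> again (\<open>integral_Bessel_J_powr\<close>). The inner exchange is needed only for those
  \<open>x\<close> at which the integral over \<open>u\<close> converges absolutely. The convergence of the iterated
  integral provides this for almost every \<open>x\<close> with \<open>f x \<noteq> 0\<close>.

  It remains to recognise \<open>G(s, (x/2)\<^sup>2)\<close> as \<open>2 (x/2) powr s * K\<^sub>s(x)\<close> when \<open>K\<close> is given by the series of
  \<open>I\<close> (\<open>Macdonald_integral_eq_Bessel_K\<close>). Let \<open>R(s, c)\<close> be the combination of series that should equal
  \<open>G(s, c)\<close>. Both satisfy \<open>\<partial>/\<partial>c X(s, c) = - X(s - 1, c)\<close> and \<open>X(s, c) = c powr s * X(- s, c)\<close>, and for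
  \<open>0 < Re s < 1\<close> both tend to \<open>\<Gamma>(s)\<close> as \<open>c \<rightarrow> 0\<close>. Hence the differences \<open>D(s, -)\<close> and \<open>D(1 - s, -)\<close>
  solve a coupled linear system with an integrable singularity at \<open>0\<close> and zero initial values, and
  iterating the resulting estimates makes them vanish (\<open>coupled_singular_system_trivial\<close>). Differentiation
  carries \<open>G = R\<close> from the strip to smaller \<open>Re s\<close>, the symmetry to larger \<open>Re s\<close>, and continuity
  in \<open>s\<close> to the lines on which \<open>Re s\<close> is an integer. Continuity of \<open>G\<close> in \<open>s\<close> also gives the limit that
  defines \<open>K\<close> at integer order.
\<close>

section \<open>Integration over the positive half-line\<close>

abbreviation pos :: "real measure" where
  "pos \<equiv> lebesgue_on {0<..}"

lemma sigma_finite_lebesgue_on: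
  fixes S :: "'a::euclidean_space set"
  assumes "S \<in> sets lebesgue"
  shows "sigma_finite_measure (lebesgue_on S)"
proof (rule sigma_finite_measure_restrict_space[OF _ assms])
  \<comment> \<open>Completion does not change the measure of Borel sets, so a countable Borel cover still serves.\<close>
  obtain C :: "'a set set" where C: "countable C" "C \<subseteq> sets lborel" "\<Union>C = space lborel"
    "\<forall>a\<in>C. emeasure lborel a \<noteq> \<infinity>"
    using sigma_finite_lborel unfolding sigma_finite_measure_def by metis
  show "sigma_finite_measure (lebesgue :: 'a measure)"
    unfolding sigma_finite_measure_def
  proof (intro exI[of _ C] conjI)
    show "C \<subseteq> sets lebesgue"
      using C(2) by auto
    show "\<forall>a\<in>C. emeasure lebesgue a \<noteq> \<infinity>"
      using C(2,4) by auto
  qed (use C in auto)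
qed

interpretation pos: sigma_finite_measure pos
  by (rule sigma_finite_lebesgue_on) simp

interpretation pos2: pair_sigma_finite pos pos ..

text \<open>
  Makes Borel measurable expressions in the variable measurable for the completed measure.
\<close>

lemma borel_measurable_pos_id [measurable]: "(\<lambda>x. x) \<in> borel_measurable pos"
  by (simp add: measurable_restrict_space1 measurable_completion)

lemma powr_of_real_pos:
  assumes "0 < t"
  shows "complex_of_real t powr s = exp (s * of_real (ln t))"
  using assms by (simp add: powr_def Ln_of_real)

lemma norm_powr_of_real_pos:
  assumes "0 < t"
  shows "norm (complex_of_real t powr s) = t powr Re s"
  using assms by (simp add: norm_powr_real_powr)

lemma powr_mult_of_real_pos:
  assumes "0 < a" "0 < b"
  shows "complex_of_real (a * b) powr s = of_real a powr s * of_real b powr s"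
  using assms
  by (simp add: powr_of_real_pos ln_mult distrib_left exp_add del: of_real_mult)

lemma powr_powr_of_real_pos:
  assumes "0 < a"
  shows "complex_of_real (a powr p) powr s = of_real a powr (of_real p * s)"
  using assms by (simp add: powr_of_real_pos ln_powr mult_ac)

text \<open>
  Measurability is inherited from the real logarithm, since on the negative axis the principal
  logarithm is \<open>ln \<bar>r\<bar> + \<i> \<pi>\<close>.
\<close>

lemma borel_measurable_powr_of_real [measurable]:
  assumes [measurable]: "g \<in> borel_measurable M"
  shows "(\<lambda>x. complex_of_real (g x) powr s) \<in> borel_measurable M"
proof -
  have "complex_of_real r powr s = (if r = 0 then 0 else
      exp (s * (of_real (ln \<bar>r\<bar>) + (if r < 0 then \<i> * of_real pi else 0))))" for r
  proof -
    consider "r > 0" | "r = 0" | "r < 0" by linarith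
    then show ?thesis
    proof cases
      case 3
      have "Ln (complex_of_real r) = Ln (- of_real (- r))" by simp
      also have "\<dots> = Ln (of_real (-r)) + \<i> * pi"
        using 3 by (subst Ln_minus) auto
      also have "Ln (of_real (-r)) = of_real (ln (-r))"
        using 3 by (subst Ln_of_real) auto
      finally show ?thesis using 3 by (simp add: powr_def)
    qed (auto simp: powr_def Ln_of_real)
  qed
  then show ?thesis by simp
qed

lemma borel_measurable_Bessel_J [measurable]:
  assumes [measurable]: "g \<in> borel_measurable M"
  shows "(\<lambda>x. Bessel_J s (g x)) \<in> borel_measurable M"
  unfolding Bessel_J_def by measurable

lemma integrable_of_abs_convergent_iterated:
  assumes [measurable]: "case_prod g \<in> borel_measurable (pos \<Otimes>\<^sub>M pos)"
    and "abs_convergent_iterated g"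
  shows "integrable (pos \<Otimes>\<^sub>M pos) (case_prod g)"
proof (rule integrableI_bounded)
  have "(\<integral>\<^sup>+ p. ennreal (norm (case_prod g p)) \<partial>(pos \<Otimes>\<^sub>M pos)) =
      (\<integral>\<^sup>+ x. \<integral>\<^sup>+ y. ennreal (norm (g x y)) \<partial>pos \<partial>pos)"
    by (subst pos.nn_integral_fst[symmetric]) auto
  then show "(\<integral>\<^sup>+ p. ennreal (norm (case_prod g p)) \<partial>(pos \<Otimes>\<^sub>M pos)) < \<infinity>"
    using assms(2) unfolding abs_convergent_iterated_def by simp
qed simp

lemma integrable_complex_mult_iff:
  fixes f :: "'a \<Rightarrow> complex"
  assumes "c \<noteq> 0"
  shows "integrable M (\<lambda>x. c * f x) \<longleftrightarrow> integrable M f"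
  using integrable_mult_right[of "inverse c" M "\<lambda>x. c * f x"] assms
  by (auto simp: mult.assoc[symmetric])

text \<open>
  The maps \<open>y \<mapsto> a * y powr p\<close> are the diffeomorphisms of the half-line needed below: dilations
  (\<open>p = 1\<close>), squares (\<open>p = 2\<close>), the inversion (\<open>p = -1\<close>) and the inverse square (\<open>p = -2\<close>).
\<close>

lemma
  fixes f :: "real \<Rightarrow> complex"
  assumes f: "integrable pos f" and a: "0 < a" and p: "p \<noteq> 0"
  shows integrable_power_substitution:
      "integrable pos (\<lambda>y. of_real (a * \<bar>p\<bar> * y powr (p - 1)) * f (a * y powr p))"
    and integral_power_substitution:
      "(\<integral>y. of_real (a * \<bar>p\<bar> * y powr (p - 1)) * f (a * y powr p) \<partial>pos) = (\<integral>t. f t \<partial>pos)"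
proof -
  let ?g = "\<lambda>y::real. a * y powr p"
  let ?h = "\<lambda>y::real. a * (p * y powr (p - 1))"
  have der: "(?g has_field_derivative ?h y) (at y within {0<..})" if "y \<in> {0<..}" for y
    using that by (auto intro!: derivative_eq_intros simp: powr_diff)
  have inj: "inj_on ?g {0<..}"
  proof (rule inj_onI)
    fix x y :: real assume xy: "x \<in> {0<..}" "y \<in> {0<..}" "?g x = ?g y"
    then have "x powr p = y powr p" using a by simp
    then have "(x powr p) powr (1/p) = (y powr p) powr (1/p)" by simp
    then show "x = y" using xy p by (simp add: powr_powr)
  qed
  have image: "?g ` {0<..} = {0<..}"
  proof (intro equalityI subsetI)
    fix t :: real assume t: "t \<in> {0<..}"
    have "?g ((t / a) powr (1 / p)) = t" using t a p by (simp add: powr_powr)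
    then show "t \<in> ?g ` {0<..}" using t a by (intro image_eqI[of _ _ "(t / a) powr (1 / p)"]) auto
  qed (use a in auto)
  have abs: "f absolutely_integrable_on ?g ` {0<..}"
    using f unfolding image set_integrable_def
    by (subst (asm) integrable_restrict_space) auto
  have *: "(\<lambda>y. \<bar>?h y\<bar> *\<^sub>R f (?g y)) absolutely_integrable_on {0<..} \<and>
      integral {0<..} (\<lambda>y. \<bar>?h y\<bar> *\<^sub>R f (?g y)) = integral (?g ` {0<..}) f"
    by (subst has_absolute_integral_change_of_variables_real[OF _ der inj]) (use abs in auto)
  have eq: "\<bar>?h y\<bar> *\<^sub>R f (?g y) = of_real (a * \<bar>p\<bar> * y powr (p - 1)) * f (?g y)" for y
    using a by (simp add: abs_mult scaleR_conv_of_real)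
  show int: "integrable pos (\<lambda>y. of_real (a * \<bar>p\<bar> * y powr (p - 1)) * f (?g y))"
    using absolutely_integrable_imp_integrable[OF conjunct1[OF *]] unfolding eq by simp
  show "(\<integral>y. of_real (a * \<bar>p\<bar> * y powr (p - 1)) * f (?g y) \<partial>pos) = (\<integral>t. f t \<partial>pos)"
    using conjunct2[OF *] lebesgue_integral_eq_integral[OF int] lebesgue_integral_eq_integral[OF f]
    unfolding eq image by simp
qed

lemma
  assumes "0 < Re s" "0 < a"
  shows integrable_Gamma_exp: "integrable pos (\<lambda>t. of_real t powr (s - 1) * of_real (exp (- (a * t))))"
    and integral_Gamma_exp:
      "(\<integral>t. of_real t powr (s - 1) * of_real (exp (- (a * t))) \<partial>pos) = Gamma s * of_real a powr (- s)"
proof -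
  let ?f = "\<lambda>t. of_real t powr (s - 1) * complex_of_real (exp (- t))"
  have eq: "?f t = of_real t powr (s - 1) / of_real (exp t)" for t
    by (simp add: exp_minus divide_inverse)
  have int: "integrable pos ?f"
    using absolutely_integrable_imp_integrable[OF absolutely_integrable_Gamma_integral'[OF assms(1)]]
    unfolding eq by simp
  have val: "(\<integral>t. ?f t \<partial>pos) = Gamma s"
    using lebesgue_integral_eq_integral[OF int] integral_unique[OF Gamma_integral_complex'[OF assms(1)]]
    unfolding eq by simp
  have scale: "of_real (a * \<bar>1\<bar> * y powr (1 - 1)) * ?f (a * y powr 1) =
      of_real a powr s * (of_real y powr (s - 1) * of_real (exp (- (a * y))))" if "y \<in> space pos" for y
  proof -
    have "0 < y" using that by simp
    then show ?thesis using assms(2) powr_mult_of_real_pos[of a y "s - 1"]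
      by (simp add: powr_diff)
  qed
  have "integrable pos (\<lambda>y. of_real a powr s * (of_real y powr (s - 1) * of_real (exp (- (a * y)))))"
    using integrable_power_substitution[OF int assms(2) one_neq_zero]
    by (subst (asm) Bochner_Integration.integrable_cong[OF refl scale]) auto
  then show "integrable pos (\<lambda>t. of_real t powr (s - 1) * of_real (exp (- (a * t))))"
    by (subst (asm) integrable_complex_mult_iff) (use assms(2) in auto)
  have "of_real a powr s * (\<integral>y. of_real y powr (s - 1) * of_real (exp (- (a * y))) \<partial>pos) = Gamma s"
    using integral_power_substitution[OF int assms(2) one_neq_zero]
    by (subst (asm) Bochner_Integration.integral_cong[OF refl scale]) (auto simp: val)
  then show "(\<integral>t. of_real t powr (s - 1) * of_real (exp (- (a * t))) \<partial>pos) = Gamma s * of_real a powr (- s)"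
    using assms(2) by (simp add: powr_minus field_simps)
qed

lemma
  assumes s: "0 < Re s" and a: "0 < a"
  shows integrable_Gamma_Gaussian:
      "integrable pos (\<lambda>u. of_real u powr (2 * s - 1) * of_real (exp (- (a * u\<^sup>2))))"
    and integral_Gamma_Gaussian:
      "(\<integral>u. of_real u powr (2 * s - 1) * of_real (exp (- (a * u\<^sup>2))) \<partial>pos) =
        Gamma s * of_real a powr (- s) / 2"
proof -
  let ?f = "\<lambda>t. of_real t powr (s - 1) * complex_of_real (exp (- (a * t)))"
  note int = integrable_Gamma_exp[OF assms]
  have two: "(2::real) \<noteq> 0" by simp
  have square: "of_real (1 * \<bar>2\<bar> * u powr (2 - 1)) * ?f (1 * u powr 2) =
      2 * (of_real u powr (2 * s - 1) * of_real (exp (- (a * u\<^sup>2))))" if "u \<in> space pos" for u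
  proof -
    have u: "0 < u" using that by simp
    have "of_real u * complex_of_real (u powr 2) powr (s - 1) = of_real u powr (2 * s - 1)"
      unfolding powr_powr_of_real_pos[OF u]
      using u by (simp add: powr_diff right_diff_distrib field_simps power2_eq_square)
    then show ?thesis using u by simp
  qed
  have "integrable pos (\<lambda>u. 2 * (of_real u powr (2 * s - 1) * complex_of_real (exp (- (a * u\<^sup>2)))))"
    using integrable_power_substitution[OF int zero_less_one two]
    by (subst (asm) Bochner_Integration.integrable_cong[OF refl square]) auto
  then show "integrable pos (\<lambda>u. of_real u powr (2 * s - 1) * of_real (exp (- (a * u\<^sup>2))))"
    by (subst (asm) integrable_complex_mult_iff) auto
  have "2 * (\<integral>u. of_real u powr (2 * s - 1) * of_real (exp (- (a * u\<^sup>2))) \<partial>pos) =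
      Gamma s * of_real a powr (- s)"
    using integral_power_substitution[OF int zero_less_one two]
    by (subst (asm) Bochner_Integration.integral_cong[OF refl square])
      (auto simp: integral_Gamma_exp[OF assms])
  then show "(\<integral>u. of_real u powr (2 * s - 1) * of_real (exp (- (a * u\<^sup>2))) \<partial>pos) =
      Gamma s * of_real a powr (- s) / 2"
    by (simp add: mult.commute)
qed

section \<open>The Macdonald integral\<close>

definition Macdonald_kernel :: "complex \<Rightarrow> real \<Rightarrow> real \<Rightarrow> complex" where
  "Macdonald_kernel s c t = of_real t powr (s - 1) * of_real (exp (- t - c / t))"

definition Macdonald_integral :: "complex \<Rightarrow> real \<Rightarrow> complex" where
  "Macdonald_integral s c = (\<integral>t. Macdonald_kernel s c t \<partial>pos)"

lemma borel_measurable_Macdonald_kernel [measurable]: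
  assumes [measurable]: "g \<in> borel_measurable M" "h \<in> borel_measurable M"
  shows "(\<lambda>x. Macdonald_kernel s (g x) (h x)) \<in> borel_measurable M"
  unfolding Macdonald_kernel_def by measurable

lemma norm_Macdonald_kernel:
  assumes "0 < t"
  shows "norm (Macdonald_kernel s c t) = t powr (Re s - 1) * exp (- t - c / t)"
  using assms by (simp add: Macdonald_kernel_def norm_mult norm_powr_of_real_pos)

lemma integrable_real_Gamma_exp:
  fixes \<sigma> :: real
  assumes "0 < \<sigma>"
  shows "integrable pos (\<lambda>t. t powr (\<sigma> - 1) * exp (- t))"
proof -
  have eq: "norm (of_real t powr (of_real \<sigma> - 1) * complex_of_real (exp (- (1 * t)))) =
      t powr (\<sigma> - 1) * exp (- t)" if "t \<in> space pos" for t
    using that by (simp add: norm_mult norm_powr_of_real_pos)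
  have "integrable pos (\<lambda>t. norm (of_real t powr (of_real \<sigma> - 1) * complex_of_real (exp (- (1 * t)))))"
    using assms by (intro integrable_norm integrable_Gamma_exp) auto
  then show ?thesis
    by (subst (asm) Bochner_Integration.integrable_cong[OF refl eq]) auto
qed

text \<open>
  Near \<open>0\<close> the factor \<open>exp (- c / t)\<close> beats every power of \<open>t\<close>: it is at most \<open>(N t / c) ^ N\<close>. With \<open>N\<close>
  large this leaves an integrand of Gamma type, so the order \<open>\<sigma>\<close> can be any real number.
\<close>

lemma integrable_real_Macdonald_kernel:
  fixes \<sigma> c :: real
  assumes c: "0 < c"
  shows "integrable pos (\<lambda>t. t powr (\<sigma> - 1) * exp (- t - c / t))"
proof -
  obtain N :: nat where N: "1 - \<sigma> < real N" "N > 0"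
    by (metis reals_Archimedean2 less_trans max_less_iff_conj of_nat_0_less_iff)
  have bound: "t powr (\<sigma> - 1) * exp (- t - c / t) \<le>
      (real N / c) ^ N * (t powr (\<sigma> + real N - 1) * exp (- t))" if t: "0 < t" for t
  proof -
    have "c / t / real N \<le> exp (c / t / real N)"
      using exp_ge_add_one_self[of "c / t / real N"] by linarith
    then have "(c / t / real N) ^ N \<le> exp (c / t / real N) ^ N"
      using c t by (intro power_mono) auto
    also have "\<dots> = exp (c / t)"
      using N by (simp add: exp_of_nat_mult[symmetric])
    finally have "exp (- (c / t)) \<le> inverse ((c / t / real N) ^ N)"
      unfolding exp_minus using c t N by (intro le_imp_inverse_le) auto
    also have "\<dots> = (real N / c) ^ N * t powr real N"
      using t c N by (simp add: powr_realpow power_divide power_mult_distrib field_simps)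
    finally have "t powr (\<sigma> - 1) * exp (- t) * exp (- (c / t)) \<le>
        t powr (\<sigma> - 1) * exp (- t) * ((real N / c) ^ N * t powr real N)"
      by (intro mult_left_mono) auto
    also have "\<dots> = (real N / c) ^ N * ((t powr (\<sigma> - 1) * t powr real N) * exp (- t))"
      by (simp only: mult_ac)
    also have "t powr (\<sigma> - 1) * t powr real N = t powr (\<sigma> + real N - 1)"
      by (simp add: powr_add[symmetric] algebra_simps)
    finally show ?thesis
      by (simp add: exp_diff exp_minus divide_inverse mult_ac)
  qed
  show ?thesis
  proof (rule Bochner_Integration.integrable_bound)
    show "integrable pos (\<lambda>t. (real N / c) ^ N * (t powr (\<sigma> + real N - 1) * exp (- t)))"
      using integrable_real_Gamma_exp[of "\<sigma> + real N"] N by simp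
    show "AE t in pos. norm (t powr (\<sigma> - 1) * exp (- t - c / t)) \<le>
        norm ((real N / c) ^ N * (t powr (\<sigma> + real N - 1) * exp (- t)))"
      using bound c by (intro AE_I2) (auto simp: abs_mult)
  qed measurable
qed

lemma integrable_Macdonald_kernel:
  assumes "0 < c"
  shows "integrable pos (Macdonald_kernel s c)"
proof (rule Bochner_Integration.integrable_bound[OF integrable_real_Macdonald_kernel[OF assms]])
  show "AE t in pos. norm (Macdonald_kernel s c t) \<le> norm (t powr (Re s - 1) * exp (- t - c / t))"
    by (intro AE_I2) (simp add: norm_Macdonald_kernel)
qed measurable

text \<open>
  The inversion \<open>t = c / y\<close> interchanges the two terms of the exponent.
\<close>

lemma Macdonald_integral_symmetric:
  assumes c: "0 < c"
  shows "Macdonald_integral s c = of_real c powr s * Macdonald_integral (- s) c"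
proof -
  have inversion: "of_real (c * \<bar>-1\<bar> * y powr (-1 - 1)) * Macdonald_kernel s c (c * y powr -1) =
      of_real c powr s * Macdonald_kernel (- s) c y" if "y \<in> space pos" for y
  proof -
    have y: "0 < y" using that by simp
    have k: "c * y powr -1 = c * inverse y" "y powr (-1 - 1) = inverse (y * y)"
      using y powr_minus[of y 2] by (auto simp: powr_minus power2_eq_square)
    have "of_real (c * inverse y) powr (s - 1) =
        of_real c powr (s - 1) * complex_of_real y powr (1 - s)"
      using c y powr_mult_of_real_pos[of c "inverse y" "s - 1"]
      by (simp add: powr_of_real_pos ln_inverse algebra_simps del: of_real_mult of_real_inverse)
    moreover have "- (c * inverse y) - c / (c * inverse y) = - y - c / y"
      using c y by (simp add: field_simps)
    ultimately have "Macdonald_kernel s c (c * inverse y) =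
        of_real c powr (s - 1) * complex_of_real y powr (1 - s) * of_real (exp (- y - c / y))"
      unfolding Macdonald_kernel_def by simp
    moreover have "of_real c powr s = of_real c * complex_of_real c powr (s - 1)"
      using c by (simp add: powr_diff)
    moreover have "complex_of_real y powr (- s - 1) = inverse (of_real (y * y)) * complex_of_real y powr (1 - s)"
      using y by (simp add: powr_diff powr_minus field_simps)
    ultimately show ?thesis
      unfolding k by (simp add: Macdonald_kernel_def mult_ac)
  qed
  have "Macdonald_integral s c =
      (\<integral>y. of_real (c * \<bar>-1\<bar> * y powr (-1 - 1)) * Macdonald_kernel s c (c * y powr -1) \<partial>pos)"
    unfolding Macdonald_integral_def
    by (rule integral_power_substitution[symmetric, OF integrable_Macdonald_kernel[OF c] c]) simp
  also have "\<dots> = (\<integral>y. of_real c powr s * Macdonald_kernel (- s) c y \<partial>pos)"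
    by (rule Bochner_Integration.integral_cong[OF refl inversion])
  finally show ?thesis
    by (simp add: Macdonald_integral_def)
qed

lemma exp_minus_one_minus_self_bound:
  fixes w :: real
  shows "\<bar>exp w - 1 - w\<bar> \<le> w\<^sup>2 * exp \<bar>w\<bar>"
proof -
  have up: "exp w - 1 \<le> w * exp w"
  proof -
    have "exp w * (1 + (- w)) \<le> exp w * exp (- w)"
      by (intro mult_left_mono exp_ge_add_one_self) auto
    then show ?thesis by (simp add: exp_minus algebra_simps)
  qed
  have *: "exp w - 1 - w \<le> w * (exp w - 1)"
    using up by (simp add: algebra_simps)
  have "w * (exp w - 1) \<le> w\<^sup>2 * exp \<bar>w\<bar>"
  proof (cases "w \<ge> 0")
    case True
    then have "w * (exp w - 1) \<le> w * (w * exp w)"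
      using up by (intro mult_left_mono) auto
    then show ?thesis using True by (simp add: power2_eq_square mult_ac)
  next
    case False
    then have "w * (exp w - 1) = (- w) * (1 - exp w)" by (simp add: algebra_simps)
    also have "\<dots> \<le> (- w) * (- w)"
    proof (rule mult_left_mono)
      show "1 - exp w \<le> - w" using exp_ge_add_one_self[of w] by linarith
    qed (use False in auto)
    also have "\<dots> = w\<^sup>2 * 1" by (simp add: power2_eq_square)
    also have "\<dots> \<le> w\<^sup>2 * exp \<bar>w\<bar>" by (intro mult_left_mono) auto
    finally show ?thesis .
  qed
  moreover have "0 \<le> exp w - 1 - w" using exp_ge_add_one_self[of w] by linarith
  ultimately show ?thesis using * by linarith
qed

text \<open>
  Differentiation under the integral sign, with an explicit quadratic remainder: with \<open>v = - h / t\<close>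
  the pointwise Taylor remainder is at most \<open>v\<^sup>2 * exp \<bar>v\<bar>\<close> times the kernel, and for \<open>\<bar>h\<bar> \<le> c / 2\<close> the growth of
  \<open>exp \<bar>v\<bar>\<close> is absorbed by half of the decay \<open>exp (- c / t)\<close>.
\<close>

lemma has_vector_derivative_Macdonald_integral:
  assumes c: "0 < c"
  shows "(Macdonald_integral s has_vector_derivative - Macdonald_integral (s - 1) c) (at c)"
proof -
  define C where "C = (\<integral>t. t powr (Re s - 2 - 1) * exp (- t - (c/2) / t) \<partial>pos)"
  have int: "integrable pos (\<lambda>t. t powr (Re s - 2 - 1) * exp (- t - (c/2) / t))"
    using c by (intro integrable_real_Macdonald_kernel) simp
  have remainder: "norm (Macdonald_integral s (c + h) - Macdonald_integral s c -
      h *\<^sub>R (- Macdonald_integral (s - 1) c)) \<le> h\<^sup>2 * C" if h: "\<bar>h\<bar> \<le> c / 2" "h \<noteq> 0" for h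
  proof -
    have ch: "0 < c + h" using c h by linarith
    note ints = integrable_Macdonald_kernel[OF ch, of s] integrable_Macdonald_kernel[OF c, of s]
      integrable_Macdonald_kernel[OF c, of "s - 1"]
    let ?d = "\<lambda>t. Macdonald_kernel s (c + h) t - Macdonald_kernel s c t + of_real h * Macdonald_kernel (s - 1) c t"
    have "Macdonald_integral s (c + h) - Macdonald_integral s c - h *\<^sub>R (- Macdonald_integral (s - 1) c)
        = (\<integral>t. ?d t \<partial>pos)"
      using ints by (simp add: Macdonald_integral_def scaleR_conv_of_real)
    also have "norm \<dots> \<le> (\<integral>t. h\<^sup>2 * (t powr (Re s - 2 - 1) * exp (- t - (c/2) / t)) \<partial>pos)"
    proof (rule Bochner_Integration.integral_norm_bound_integral)
      show "integrable pos ?d" using ints by auto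
      show "integrable pos (\<lambda>t. h\<^sup>2 * (t powr (Re s - 2 - 1) * exp (- t - (c/2) / t)))"
        using int by simp
      fix t assume "t \<in> space pos"
      then have t: "0 < t" by simp
      define v where "v = - (h / t)"
      have "?d t = Macdonald_kernel s c t * of_real (exp v - 1 - v)"
      proof -
        have "exp (- t - (c + h) / t) = exp (- t - c / t) * exp v"
          by (simp add: v_def exp_add[symmetric] add_divide_distrib)
        moreover have "of_real h * Macdonald_kernel (s - 1) c t = - (of_real v * Macdonald_kernel s c t)"
          using t powr_diff[of "complex_of_real t" "s - 1" 1]
          by (simp add: v_def Macdonald_kernel_def field_simps)
        ultimately show ?thesis
          by (simp add: Macdonald_kernel_def algebra_simps)
      qed
      then have "norm (?d t) = t powr (Re s - 1) * exp (- t - c / t) * \<bar>exp v - 1 - v\<bar>"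
        using norm_Macdonald_kernel[OF t] by (simp only: norm_mult norm_of_real)
      also have "\<dots> \<le> t powr (Re s - 1) * exp (- t - c / t) * (v\<^sup>2 * exp \<bar>v\<bar>)"
        by (intro mult_left_mono exp_minus_one_minus_self_bound) auto
      also have "\<dots> = h\<^sup>2 * (t powr (Re s - 2 - 1) * (exp (- t - c / t) * exp \<bar>v\<bar>))"
        using t powr_diff[of t "Re s - 1" 2]
        by (simp add: v_def power_divide algebra_simps)
      also have "\<dots> \<le> h\<^sup>2 * (t powr (Re s - 2 - 1) * exp (- t - (c/2) / t))"
      proof -
        have "\<bar>v\<bar> \<le> (c / 2) / t"
          unfolding v_def abs_minus_cancel abs_divide using h t
          by (simp only: abs_of_pos) (intro divide_right_mono, auto)
        then have "- t - c / t + \<bar>v\<bar> \<le> - t - (c / 2) / t"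
          using t by (simp add: field_simps)
        then show ?thesis
          by (intro mult_left_mono) (auto simp: exp_add[symmetric])
      qed
      finally show "norm (?d t) \<le> h\<^sup>2 * (t powr (Re s - 2 - 1) * exp (- t - (c/2) / t))" .
    qed
    finally show ?thesis by (simp add: C_def)
  qed
  have "(\<lambda>h. norm (Macdonald_integral s (c + h) - Macdonald_integral s c -
      h *\<^sub>R (- Macdonald_integral (s - 1) c)) / norm h) \<midarrow>0\<rightarrow> 0"
  proof (rule Lim_null_comparison)
    have "eventually (\<lambda>h. h \<noteq> 0 \<and> \<bar>h\<bar> < c / 2) (at 0)"
      using c by (auto simp: eventually_at intro!: exI[of _ "c/2"])
    then show "\<forall>\<^sub>F h in at 0. norm (norm (Macdonald_integral s (c + h) - Macdonald_integral s c -
      h *\<^sub>R (- Macdonald_integral (s - 1) c)) / norm h) \<le> \<bar>h\<bar> * C"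
    proof eventually_elim
      case (elim h)
      then show ?case
        using remainder[of h] by (simp add: field_simps power2_eq_square)
    qed
    show "((\<lambda>h. \<bar>h\<bar> * C) \<longlongrightarrow> 0) (at 0)"
      by (auto intro!: tendsto_eq_intros)
  qed
  then show ?thesis
    unfolding has_vector_derivative_def has_derivative_at
    using bounded_linear_scaleR_left by blast
qed

text \<open>
  The estimate \<open>1 - exp (- v) \<le> v powr e\<close> for \<open>0 < e \<le> 1\<close> bounds the distance to the Gamma integral by
  \<open>c powr e\<close> times a Gamma integral of order \<open>Re s - e\<close>, which converges for \<open>e < Re s\<close>.
\<close>

lemma tendsto_Macdonald_integral_Gamma:
  assumes s: "0 < Re s"
  shows "(Macdonald_integral s \<longlongrightarrow> Gamma s) (at_right 0)"
proof -
  define e where "e = min 1 (Re s / 2)"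
  have e: "0 < e" "e \<le> 1" "e < Re s" using s by (auto simp: e_def)
  define C where "C = (\<integral>t. t powr (Re s - e - 1) * exp (- t) \<partial>pos)"
  have int: "integrable pos (\<lambda>t. t powr (Re s - e - 1) * exp (- t))"
    using e by (intro integrable_real_Gamma_exp) simp
  note G = integrable_Gamma_exp[OF s zero_less_one] integral_Gamma_exp[OF s zero_less_one]
  have bound: "norm (Macdonald_integral s c - Gamma s) \<le> c powr e * C" if c: "0 < c" for c
  proof -
    let ?d = "\<lambda>t. Macdonald_kernel s c t - of_real t powr (s - 1) * of_real (exp (- (1 * t)))"
    have "Macdonald_integral s c - Gamma s = (\<integral>t. ?d t \<partial>pos)"
      using G integrable_Macdonald_kernel[OF c, of s] by (simp add: Macdonald_integral_def)
    also have "norm \<dots> \<le> (\<integral>t. c powr e * (t powr (Re s - e - 1) * exp (- t)) \<partial>pos)"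
    proof (rule Bochner_Integration.integral_norm_bound_integral)
      show "integrable pos ?d" using G integrable_Macdonald_kernel[OF c, of s] by auto
      show "integrable pos (\<lambda>t. c powr e * (t powr (Re s - e - 1) * exp (- t)))"
        using int by simp
      fix t assume "t \<in> space pos"
      then have t: "0 < t" by simp
      have "?d t = - (of_real t powr (s - 1)) * of_real (exp (- t)) * of_real (1 - exp (- (c / t)))"
        by (simp add: Macdonald_kernel_def exp_diff exp_minus field_simps)
      then have "norm (?d t) = t powr (Re s - 1) * exp (- t) * \<bar>1 - exp (- (c / t))\<bar>"
        using t by (simp only: norm_mult norm_of_real norm_minus_cancel norm_powr_of_real_pos) simp
      also have "\<bar>1 - exp (- (c / t))\<bar> = 1 - exp (- (c / t))"
        using c t by simp
      also have "1 - exp (- (c / t)) \<le> (c / t) powr e"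
      proof (cases "c / t \<ge> 1")
        case True
        then have "1 \<le> (c / t) powr e" using e by (simp add: ge_one_powr_ge_zero)
        then show ?thesis by (smt (verit) exp_gt_zero)
      next
        case False
        have "1 - exp (- (c / t)) \<le> c / t"
          using exp_ge_add_one_self[of "- (c / t)"] by linarith
        also have "\<dots> \<le> (c / t) powr e"
          using powr_mono'[of e 1 "c / t"] False e c t by simp
        finally show ?thesis .
      qed
      also have "(c / t) powr e = c powr e * t powr (- e)"
        using c t by (simp add: powr_divide powr_minus_divide)
      also have "t powr (Re s - 1) * exp (- t) * (c powr e * t powr - e) =
          c powr e * ((t powr (Re s - 1) * t powr - e) * exp (- t))"
        by (simp only: mult_ac)
      also have "t powr (Re s - 1) * t powr - e = t powr (Re s - e - 1)"
        by (simp add: powr_add[symmetric] algebra_simps)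
      finally show "norm (?d t) \<le> c powr e * (t powr (Re s - e - 1) * exp (- t))"
        by (simp add: mult_left_mono)
    qed
    finally show ?thesis by (simp add: C_def)
  qed
  have "((\<lambda>c. Macdonald_integral s c - Gamma s) \<longlongrightarrow> 0) (at_right 0)"
  proof (rule Lim_null_comparison)
    show "\<forall>\<^sub>F c in at_right 0. norm (Macdonald_integral s c - Gamma s) \<le> c powr e * C"
      using bound by (auto simp: eventually_at_right_field intro!: exI[of _ 1])
    have "((\<lambda>c. c powr e) \<longlongrightarrow> 0 powr e) (at_right (0::real))"
      using e by (intro tendsto_powr' tendsto_intros) (auto simp: eventually_at_right_field intro!: exI[of _ 1])
    then show "((\<lambda>c. c powr e * C) \<longlongrightarrow> 0) (at_right 0)"
      using tendsto_mult_left_zero[of "\<lambda>c. c powr e"] e by simp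
  qed
  then show ?thesis by (simp add: LIM_zero_iff)
qed

lemma norm_exp_minus_one_le:
  fixes z :: complex
  shows "norm (exp z - 1) \<le> norm z * exp (norm z)"
proof -
  have "norm (exp z - exp 0) \<le> exp (norm z) * norm (z - 0)"
  proof (rule field_differentiable_bound[of "cball 0 (norm z)"])
    fix w :: complex assume "w \<in> cball 0 (norm z)"
    then show "norm (exp w) \<le> exp (norm z)"
      using norm_exp[of w] by (simp add: order_trans)
  qed (auto intro!: derivative_eq_intros)
  then show ?thesis by (simp add: mult.commute)
qed

text \<open>
  Changing the order by \<open>d\<close> multiplies the kernel by \<open>exp (d * ln t)\<close>. For \<open>norm d \<le> 1\<close> this differs
  from \<open>1\<close> by at most \<open>norm d * (t powr 2 + t powr -2)\<close>, so the order is locally Lipschitz.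
\<close>

lemma isCont_Macdonald_integral_order:
  assumes c: "0 < c"
  shows "isCont (\<lambda>s. Macdonald_integral s c) s"
proof -
  define I where "I r t = t powr (Re s + r - 1) * exp (- t - c / t)" for r t :: real
  define C where "C = (\<integral>t. I 2 t + I (-2) t \<partial>pos)"
  have int: "integrable pos (I r)" for r
    unfolding I_def using integrable_real_Macdonald_kernel[OF c] .
  have bound: "norm (Macdonald_integral (s + d) c - Macdonald_integral s c) \<le> norm d * C"
    if d: "norm d \<le> 1" for d
  proof -
    let ?d = "\<lambda>t. Macdonald_kernel (s + d) c t - Macdonald_kernel s c t"
    note ints = integrable_Macdonald_kernel[OF c, of "s + d"] integrable_Macdonald_kernel[OF c, of s]
    have "Macdonald_integral (s + d) c - Macdonald_integral s c = (\<integral>t. ?d t \<partial>pos)"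
      using ints by (simp add: Macdonald_integral_def)
    also have "norm \<dots> \<le> (\<integral>t. norm d * (I 2 t + I (-2) t) \<partial>pos)"
    proof (rule Bochner_Integration.integral_norm_bound_integral)
      show "integrable pos ?d" using ints by auto
      show "integrable pos (\<lambda>t. norm d * (I 2 t + I (-2) t))" using int by simp
      fix t assume "t \<in> space pos"
      then have t: "0 < t" by simp
      let ?l = "of_real (ln t) :: complex"
      have "?d t = Macdonald_kernel s c t * (exp (d * ?l) - 1)"
      proof -
        have "of_real t powr (s + d - 1) = of_real t powr (s - 1) * exp (d * ?l)"
          using t by (simp add: powr_of_real_pos exp_add[symmetric] algebra_simps)
        then show ?thesis by (simp add: Macdonald_kernel_def algebra_simps)
      qed
      then have "norm (?d t) = t powr (Re s - 1) * exp (- t - c / t) * norm (exp (d * ?l) - 1)"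
        using t by (simp add: norm_mult norm_Macdonald_kernel)
      also have "norm (exp (d * ?l) - 1) \<le> norm d * (t powr 2 + t powr -2)"
      proof -
        have "norm (exp (d * ?l) - 1) \<le> norm (d * ?l) * exp (norm (d * ?l))"
          by (rule norm_exp_minus_one_le)
        also have "\<dots> = norm d * (\<bar>ln t\<bar> * exp (norm d * \<bar>ln t\<bar>))"
          by (simp add: norm_mult)
        also have "\<dots> \<le> norm d * (exp \<bar>ln t\<bar> * exp \<bar>ln t\<bar>)"
        proof (intro mult_left_mono mult_mono)
          show "\<bar>ln t\<bar> \<le> exp \<bar>ln t\<bar>" using exp_ge_add_one_self[of "\<bar>ln t\<bar>"] by linarith
          show "exp (norm d * \<bar>ln t\<bar>) \<le> exp \<bar>ln t\<bar>" using d by (simp add: mult_left_le_one_le)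
        qed auto
        also have "exp \<bar>ln t\<bar> * exp \<bar>ln t\<bar> \<le> t powr 2 + t powr -2"
        proof -
          have "exp \<bar>l\<bar> * exp \<bar>l\<bar> \<le> exp (2 * l) + exp (- 2 * l)" for l :: real
            by (cases "l \<ge> 0") (auto simp: exp_add[symmetric])
          then show ?thesis using t unfolding powr_def by simp
        qed
        finally show ?thesis by (simp add: mult_left_mono)
      qed
      also have "t powr (Re s - 1) * exp (- t - c / t) * (norm d * (t powr 2 + t powr -2)) =
          norm d * (I 2 t + I (-2) t)"
      proof -
        have I_eq: "I r t = t powr r * (t powr (Re s - 1) * exp (- t - c / t))" for r
          unfolding I_def by (simp add: powr_add[symmetric] algebra_simps)
        show ?thesis unfolding I_eq by (simp only: algebra_simps)
      qed
      finally show "norm (?d t) \<le> norm d * (I 2 t + I (-2) t)" by (simp add: mult_left_mono)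
    qed
    finally show ?thesis by (simp add: C_def)
  qed
  have "((\<lambda>d. Macdonald_integral (s + d) c - Macdonald_integral s c) \<longlongrightarrow> 0) (at 0)"
  proof (rule Lim_null_comparison)
    show "\<forall>\<^sub>F d in at 0. norm (Macdonald_integral (s + d) c - Macdonald_integral s c) \<le> norm d * C"
      using bound by (auto simp: eventually_at intro!: exI[of _ 1])
    show "((\<lambda>d. norm d * C) \<longlongrightarrow> 0) (at 0)"
      by (auto intro!: tendsto_eq_intros)
  qed
  then show ?thesis
    by (simp add: isCont_iff LIM_zero_iff)
qed

section \<open>Bessel series\<close>

text \<open>
  Common power series of \<open>I\<close> (positive argument) and \<open>J\<close> (negative argument).
\<close>

definition Bessel_series :: "complex \<Rightarrow> complex \<Rightarrow> complex" where
  "Bessel_series s w = (\<Sum>m. rGamma (of_nat m + s + 1) / fact m * w ^ m)"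

lemma Bessel_J_eq_series: "Bessel_J s x = of_real (x / 2) powr s * Bessel_series s (- of_real ((x / 2)\<^sup>2))"
proof -
  have "(- complex_of_real ((x / 2)\<^sup>2)) ^ m = (-1) ^ m * of_real (x / 2) ^ (2 * m)" for m
    by (subst power_minus) (simp add: power_mult)
  then show ?thesis
    by (simp add: Bessel_J_def Bessel_series_def mult_ac)
qed

lemma Bessel_I_eq_series: "Bessel_I s x = of_real (x / 2) powr s * Bessel_series s (of_real ((x / 2)\<^sup>2))"
  by (simp add: Bessel_I_def Bessel_series_def power_mult)

text \<open>
  Once \<open>norm (m + s) \<ge> 1\<close>, the functional equation shows that \<open>norm (rGamma (m + s))\<close> no longer increases with \<open>m\<close>, so only
  finitely many shifts have to be bounded by compactness. Uniformity in \<open>s\<close> is what makes the Bessel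
  series continuous in its order.
\<close>

lemma rGamma_shift_bounded_on_compact:
  assumes S: "compact S"
  obtains B where "\<And>s m. s \<in> S \<Longrightarrow> norm (rGamma (of_nat m + s :: complex)) \<le> B"
proof -
  obtain r where r: "\<And>s. s \<in> S \<Longrightarrow> norm s \<le> r"
    using compact_imp_bounded[OF S] by (auto simp: bounded_iff)
  obtain N :: nat where N: "r + 1 \<le> real N"
    using real_arch_simple by blast
  have "\<exists>b. \<forall>s\<in>S. norm (rGamma (of_nat m + s)) \<le> b" for m
  proof -
    have "compact ((\<lambda>s. rGamma (of_nat m + s)) ` S)"
      by (intro compact_continuous_image S)
        (intro continuous_on_compose2[OF continuous_on_rGamma[of UNIV]] continuous_intros, auto)
    then show ?thesis using compact_imp_bounded by (fastforce simp: bounded_iff)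
  qed
  then obtain b where b: "\<And>m s. s \<in> S \<Longrightarrow> norm (rGamma (of_nat m + s)) \<le> b m" by metis
  define B where "B = (\<Sum>m\<le>N. \<bar>b m\<bar>)"
  have "norm (rGamma (of_nat m + s)) \<le> B" if s: "s \<in> S" for m s
  proof (cases "m \<le> N")
    case True
    have "\<bar>b m\<bar> \<le> B"
      unfolding B_def by (rule member_le_sum) (use True in auto)
    then show ?thesis using b[OF s, of m] by linarith
  next
    case False
    then have "N \<le> m" by simp
    then show ?thesis
    proof (induction m rule: dec_induct)
      case base
      have "\<bar>b N\<bar> \<le> B"
        unfolding B_def by (rule member_le_sum) auto
      then show ?case using b[OF s, of N] by linarith
    next
      case (step m)
      have "norm (of_nat m :: complex) - norm s \<le> norm (of_nat m + s)"
        by (metis add.commute add_diff_cancel norm_diff_ineq diff_le_eq norm_triangle_ineq4)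
      moreover have "r + 1 \<le> real m" using N step(1) by linarith
      ultimately have "1 \<le> norm (of_nat m + s)"
        using r[OF s] by simp
      then have "norm (rGamma (of_nat (Suc m) + s)) \<le>
          norm (of_nat m + s) * norm (rGamma (of_nat (Suc m) + s))"
        using mult_right_mono[of 1 "norm (of_nat m + s)"] by auto
      also have "\<dots> = norm (rGamma (of_nat m + s))"
        using rGamma_plus1[of "of_nat m + s"] by (simp add: norm_mult[symmetric] add_ac)
      finally show ?case using step by simp
    qed
  qed
  then show ?thesis using that by blast
qed

lemma of_nat_Suc_divide_fact_Suc: "of_nat (Suc m) * (r / fact (Suc m)) = (r / fact m :: complex)"
  by (simp del: of_nat_Suc)

lemma summable_exp_bound: "summable (\<lambda>m. B / fact m * (x::real) ^ m)"
  using summable_mult[OF summable_exp[of x], of B] by (simp add: divide_inverse mult_ac)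

lemma norm_Bessel_series_term_le:
  fixes s w :: complex
  assumes "norm (rGamma (of_nat m + s + 1)) \<le> B"
  shows "norm (rGamma (of_nat m + s + 1) / fact m * w ^ m) \<le> B / fact m * norm w ^ m"
  using assms by (simp add: norm_mult norm_divide norm_power mult_right_mono divide_right_mono)

lemma summable_Bessel_series: "summable (\<lambda>m. rGamma (of_nat m + s + 1) / fact m * w ^ m :: complex)"
proof -
  obtain B where B: "\<And>m. norm (rGamma (of_nat m + (s + 1))) \<le> B"
    by (metis rGamma_shift_bounded_on_compact[of "{s + 1}"] compact_sing singletonI)
  show ?thesis
  proof (rule summable_comparison_test')
    show "norm (rGamma (of_nat m + s + 1) / fact m * w ^ m) \<le> B / fact m * norm w ^ m" for m
      using B[of m] by (intro norm_Bessel_series_term_le) (simp add: add.assoc)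
  qed (rule summable_exp_bound)
qed

lemma has_field_derivative_Bessel_series:
  "(Bessel_series s has_field_derivative Bessel_series (s + 1) w) (at w)"
proof -
  have "diffs (\<lambda>m. rGamma (of_nat m + s + 1) / fact m) = (\<lambda>m. rGamma (of_nat m + (s + 1) + 1) / fact m :: complex)"
    using of_nat_Suc_divide_fact_Suc by (simp add: diffs_def fun_eq_iff add_ac)
  then show ?thesis
    using termdiffs_strong_converges_everywhere[OF summable_Bessel_series, of s w]
    unfolding Bessel_series_def[abs_def] by simp
qed

lemma Bessel_series_0: "Bessel_series s 0 = rGamma (s + 1)"
  using powser_zero[of "\<lambda>m. rGamma (of_nat m + s + 1) / fact m :: complex"]
  by (simp add: Bessel_series_def)

text \<open>
  The coefficients satisfy \<open>(m + s) * rGamma (m + s + 1) = rGamma (m + s)\<close>; the part \<open>m\<close> of the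
  factor shifts the index and produces the series of order \<open>s + 1\<close>.
\<close>

lemma Bessel_series_recurrence:
  "s * Bessel_series s w + w * Bessel_series (s + 1) w = Bessel_series (s - 1) w"
proof -
  let ?a = "\<lambda>s m. rGamma (of_nat m + s + 1) / fact m * w ^ m"
  have sums: "?a s sums Bessel_series s w" for s
    unfolding Bessel_series_def using summable_Bessel_series by (rule summable_sums)
  let ?b = "\<lambda>m. of_nat m * ?a s m"
  have "?b (Suc m) = w * ?a (s + 1) m" for m
    using of_nat_Suc_divide_fact_Suc[of m "rGamma (of_nat m + s + 2) * w ^ Suc m"]
    by (simp add: add_ac mult_ac)
  then have "(\<lambda>m. ?b (Suc m)) sums (w * Bessel_series (s + 1) w)"
    using sums_mult[OF sums[of "s + 1"], of w] by simp
  then have "?b sums (w * Bessel_series (s + 1) w)"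
    by (subst (asm) sums_Suc_iff) simp
  then have "(\<lambda>m. s * ?a s m + ?b m) sums (s * Bessel_series s w + w * Bessel_series (s + 1) w)"
    by (intro sums_add sums_mult sums)
  moreover have "s * ?a s m + ?b m = ?a (s - 1) m" for m
    using rGamma_plus1[of "of_nat m + s", symmetric] by (simp add: algebra_simps add_divide_distrib[symmetric])
  ultimately show ?thesis
    using sums[of "s - 1"] sums_unique2 by simp
qed

lemma isCont_Bessel_series_order: "isCont (\<lambda>s. Bessel_series s w) s"
proof -
  \<comment> \<open>The uniform bound is stated for shifts of the argument of \<open>rGamma\<close>, which is the order plus one.\<close>
  have "compact ((\<lambda>s. s + 1) ` cball s 1)"
    by (intro compact_continuous_image continuous_intros compact_cball)
  then obtain B where "\<And>v m. v \<in> (\<lambda>s. s + 1) ` cball s 1 \<Longrightarrow> norm (rGamma (of_nat m + v :: complex)) \<le> B"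
    using rGamma_shift_bounded_on_compact by metis
  then have B: "norm (rGamma (of_nat m + v + 1)) \<le> B" if "v \<in> cball s 1" for v m
    using that by (simp add: add.assoc)
  have "uniform_limit (cball s 1) (\<lambda>n v. \<Sum>m<n. rGamma (of_nat m + v + 1) / fact m * w ^ m)
      (\<lambda>v. \<Sum>m. rGamma (of_nat m + v + 1) / fact m * w ^ m) sequentially"
    by (rule Weierstrass_m_test[OF norm_Bessel_series_term_le[OF B] summable_exp_bound])
  then have "continuous_on (cball s 1) (\<lambda>v. Bessel_series v w)"
    unfolding Bessel_series_def
    by (rule uniform_limit_theorem[rotated])
      (auto intro!: continuous_intros continuous_on_compose2[OF continuous_on_rGamma[of UNIV]] always_eventually)
  then show ?thesis
    by (rule continuous_on_interior) simp
qed

text \<open>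
  The expansion about \<open>c = 0\<close> that the Macdonald integral has at non-integer order.
\<close>

definition Macdonald_series :: "complex \<Rightarrow> real \<Rightarrow> complex" where
  "Macdonald_series s c = of_real pi / sin (of_real pi * s) *
     (Bessel_series (- s) (of_real c) - of_real c powr s * Bessel_series s (of_real c))"

lemma Macdonald_series_symmetric:
  assumes "0 < c"
  shows "Macdonald_series s c = of_real c powr s * Macdonald_series (- s) c"
  using assms by (simp add: Macdonald_series_def powr_minus algebra_simps field_simps)

text \<open>
  The two series differentiate to the two series of order \<open>s - 1\<close>, the second one by
  \<open>Bessel_series_recurrence\<close>; the minus sign comes from \<open>sin (\<pi> (s - 1)) = - sin (\<pi> s)\<close>.
\<close>

lemma has_vector_derivative_Macdonald_series:
  assumes c: "0 < c"
  shows "(Macdonald_series s has_vector_derivative - Macdonald_series (s - 1) c) (at c)"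
proof -
  let ?F = "\<lambda>w. of_real pi / sin (of_real pi * s) * (Bessel_series (- s) w - w powr s * Bessel_series s w)"
  let ?w = "complex_of_real c"
  have "(?F has_field_derivative of_real pi / sin (of_real pi * s) *
      (Bessel_series (- s + 1) ?w - (s * ?w powr (s - 1) * Bessel_series s ?w + ?w powr s * Bessel_series (s + 1) ?w)))
      (at ?w)"
    using c by (intro DERIV_cmult) (auto intro!: derivative_eq_intros has_field_derivative_Bessel_series)
  also have "s * ?w powr (s - 1) * Bessel_series s ?w + ?w powr s * Bessel_series (s + 1) ?w =
      ?w powr (s - 1) * (s * Bessel_series s ?w + ?w * Bessel_series (s + 1) ?w)"
    using c by (simp add: powr_diff algebra_simps)
  also have "\<dots> = ?w powr (s - 1) * Bessel_series (s - 1) ?w"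
    by (simp only: Bessel_series_recurrence)
  also have "of_real pi / sin (of_real pi * s) * (Bessel_series (- s + 1) ?w - \<dots>) = - Macdonald_series (s - 1) c"
  proof -
    have "sin (of_real pi * (s - 1)) = - sin (of_real pi * s)"
      by (simp add: right_diff_distrib sin_diff)
    then show ?thesis by (simp add: Macdonald_series_def)
  qed
  finally show ?thesis
    unfolding Macdonald_series_def[abs_def]
    by (rule has_vector_derivative_real_field)
qed

text \<open>
  Only the constant term \<open>rGamma (1 - s)\<close> survives, and the reflection formula turns it into \<open>\<Gamma>(s)\<close>.
\<close>

lemma tendsto_Macdonald_series_Gamma:
  assumes s: "0 < Re s" "s \<notin> \<int>"
  shows "(Macdonald_series s \<longlongrightarrow> Gamma s) (at_right 0)"
proof -
  have "isCont (Bessel_series v) w" for v w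
    using has_field_derivative_Bessel_series DERIV_isCont by blast
  then have B: "((\<lambda>c. Bessel_series v (complex_of_real c)) \<longlongrightarrow> rGamma (v + 1)) (at_right 0)" for v
    using isCont_tendsto_compose[of 0 "Bessel_series v" of_real "at_right (0::real)"]
      tendsto_of_real[of "\<lambda>x::real. x" 0 "at_right 0"]
    by (simp add: Bessel_series_0 tendsto_ident_at)
  have P: "((\<lambda>c. complex_of_real c powr s) \<longlongrightarrow> 0) (at_right 0)"
  proof (rule Lim_null_comparison)
    show "\<forall>\<^sub>F c in at_right 0. norm (complex_of_real c powr s) \<le> c powr Re s"
      by (auto simp: eventually_at_right_field norm_powr_of_real_pos intro!: exI[of _ 1])
    have "((\<lambda>c. c powr Re s) \<longlongrightarrow> 0 powr Re s) (at_right (0::real))"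
      using s by (intro tendsto_powr' tendsto_intros) (auto simp: eventually_at_right_field intro!: exI[of _ 1])
    then show "((\<lambda>c. c powr Re s) \<longlongrightarrow> 0) (at_right (0::real))" by simp
  qed
  have "(Macdonald_series s \<longlongrightarrow> of_real pi / sin (of_real pi * s) *
      (rGamma (- s + 1) - 0 * rGamma (s + 1))) (at_right 0)"
    unfolding Macdonald_series_def[abs_def]
    by (intro tendsto_intros B P)
  moreover have "of_real pi / sin (of_real pi * s) * (rGamma (- s + 1) - 0 * rGamma (s + 1)) = Gamma s"
  proof -
    have "rGamma s \<noteq> 0" using s(2) by (auto simp: rGamma_eq_zero_iff elim!: nonpos_Ints_cases)
    moreover have "sin (of_real pi * s) \<noteq> 0"
      using s(2) by (auto simp: sin_eq_0)
    ultimately show ?thesis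
      using rGamma_reflection_complex[of s] by (simp add: Gamma_def field_simps)
  qed
  ultimately show ?thesis by simp
qed

lemma isCont_Macdonald_series_order:
  assumes "s \<notin> \<int>" "0 < c"
  shows "isCont (\<lambda>s. Macdonald_series s c) s"
proof -
  have "isCont (\<lambda>s. Bessel_series (- s) (of_real c)) s"
    by (rule isCont_o2[OF _ isCont_Bessel_series_order]) (intro continuous_intros)
  moreover have "sin (of_real pi * s) \<noteq> 0"
    using assms by (auto simp: sin_eq_0)
  moreover have "isCont (\<lambda>s. complex_of_real c powr s) s"
    using has_field_derivative_powr_right[of "of_real c"] DERIV_isCont assms by auto
  ultimately show ?thesis
    unfolding Macdonald_series_def
    by (intro continuous_intros isCont_Bessel_series_order) (use assms in auto)
qed

lemma Bessel_K_nonint_eq_Macdonald_series: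
  assumes "0 < x"
  shows "2 * of_real (x / 2) powr s * Bessel_K_nonint s x = Macdonald_series s ((x / 2)\<^sup>2)"
proof -
  define P where "P = complex_of_real (x / 2) powr s"
  have P: "P \<noteq> 0" using assms by (simp add: P_def)
  have square: "complex_of_real ((x / 2)\<^sup>2) powr s = P * P"
    using assms powr_mult_of_real_pos[of "x/2" "x/2" s] by (simp add: power2_eq_square P_def)
  have inverse: "complex_of_real (x / 2) powr (- s) = inverse P"
    by (simp add: P_def powr_minus)
  let ?X = "Bessel_series (- s) (of_real ((x / 2)\<^sup>2))" and ?Y = "Bessel_series s (of_real ((x / 2)\<^sup>2))"
  have "P * (inverse P * ?X - P * ?Y) = ?X - P * P * ?Y"
    using P by (simp add: right_diff_distrib mult.assoc[symmetric])
  moreover have "2 * P * (of_real pi / 2 * D / sin (s * of_real pi)) =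
      of_real pi / sin (of_real pi * s) * (P * D)" for D
    by (simp add: mult.commute)
  ultimately show ?thesis
    unfolding Bessel_K_nonint_def Macdonald_series_def Bessel_I_eq_series P_def[symmetric] square inverse
    by metis
qed

section \<open>Identification of the Macdonald integral with K\<close>

text \<open>
  Integration of the derivative bound from \<open>0\<close>. Since \<open>x powr (q - 1)\<close> may be unbounded at \<open>0\<close>, the mean
  value inequality is used on \<open>[e, x]\<close>, and then \<open>e \<rightarrow> 0\<close>.
\<close>

lemma norm_le_powr_of_derivative_bound:
  fixes a :: "real \<Rightarrow> complex"
  assumes deriv: "\<And>x. 0 < x \<Longrightarrow> (a has_vector_derivative a' x) (at x)"
    and bound: "\<And>x. \<lbrakk>0 < x; x < T\<rbrakk> \<Longrightarrow> norm (a' x) \<le> C * x powr (q - 1)"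
    and q: "0 < q" and C: "0 \<le> C"
    and lim: "(a \<longlongrightarrow> 0) (at_right 0)"
    and x: "0 < x" "x \<le> T"
  shows "norm (a x) \<le> C / q * x powr q"
proof -
  have bd: "norm (a x - a e) \<le> C / q * x powr q" if e: "0 < e" "e < x" for e
  proof -
    have "norm (a x - a e) \<le> C / q * x powr q - C / q * e powr q"
    proof (rule differentiable_bound_general[OF e(2)])
      show "continuous_on {e..x} a"
        using has_vector_derivative_continuous[OF deriv] e
        by (intro continuous_at_imp_continuous_on) auto
      show "continuous_on {e..x} (\<lambda>y. C / q * y powr q)"
        using e by (intro continuous_intros) auto
      show "(a has_vector_derivative a' y) (at y)" if "e < y" "y < x" for y
        using deriv that e by simp
      show "((\<lambda>y. C / q * y powr q) has_vector_derivative C * y powr (q - 1)) (at y)" if "e < y" "y < x" for y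
        unfolding has_real_derivative_iff_has_vector_derivative[symmetric]
        using that e q by (auto intro!: derivative_eq_intros)
      show "norm (a' y) \<le> C * y powr (q - 1)" if "e < y" "y < x" for y
        using bound that e x by simp
    qed
    also have "\<dots> \<le> C / q * x powr q" using C q by simp
    finally show ?thesis .
  qed
  have "((\<lambda>e. norm (a x - a e)) \<longlongrightarrow> norm (a x - 0)) (at_right 0)"
    by (intro tendsto_intros lim)
  moreover have "\<forall>\<^sub>F e in at_right 0. norm (a x - a e) \<le> C / q * x powr q"
    using bd x by (auto simp: eventually_at_right_field intro!: exI[of _ x])
  ultimately show ?thesis
    using tendsto_upperbound[of _ _ "at_right (0::real)"] by fastforce
qed

text \<open>
  A Picard iteration. If \<open>norm (a y) \<le> K * y powr n\<close>, integrating the bound for \<open>b'\<close> and then the one for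
  \<open>a'\<close> improves this to \<open>norm (a y) \<le> K / ((n + 1 - \<sigma>) (n + 1)) * y powr (n + 1)\<close>. The singularities have exponents
  \<open>\<sigma> - 1\<close> and \<open>- \<sigma>\<close>, both integrable, and the accumulated constants are at most
  \<open>(1 / (1 - \<sigma>)) ^ n / n!\<close>.
\<close>

lemma coupled_singular_system_trivial:
  fixes a b :: "real \<Rightarrow> complex"
  assumes \<sigma>: "0 < \<sigma>" "\<sigma> < 1"
    and a': "\<And>x. 0 < x \<Longrightarrow> (a has_vector_derivative a' x) (at x)"
    and b': "\<And>x. 0 < x \<Longrightarrow> (b has_vector_derivative b' x) (at x)"
    and a'_bound: "\<And>x. 0 < x \<Longrightarrow> norm (a' x) \<le> x powr (\<sigma> - 1) * norm (b x)"
    and b'_bound: "\<And>x. 0 < x \<Longrightarrow> norm (b' x) \<le> x powr (- \<sigma>) * norm (a x)"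
    and lim: "(a \<longlongrightarrow> 0) (at_right 0)" "(b \<longlongrightarrow> 0) (at_right 0)"
    and x: "0 < x"
  shows "a x = 0"
proof -
  \<comment> \<open>A bound for \<open>a\<close> on the whole of \<open>(0, x]\<close>: near \<open>0\<close> by its limit, elsewhere by compactness.\<close>
  obtain A where A: "\<And>y. \<lbrakk>0 < y; y \<le> x\<rbrakk> \<Longrightarrow> norm (a y) \<le> A"
  proof -
    have "eventually (\<lambda>y. norm (a y) < 1) (at_right 0)"
      using order_tendstoD(2)[OF tendsto_norm_zero[OF lim(1)], of 1] by simp
    then obtain d where d: "d > 0" "\<And>y. \<lbrakk>0 < y; y < d\<rbrakk> \<Longrightarrow> norm (a y) < 1"
      by (auto simp: eventually_at_right_field)
    have "compact (a ` {d..x})"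
      using has_vector_derivative_continuous[OF a'] d
      by (intro compact_continuous_image continuous_at_imp_continuous_on compact_Icc) auto
    then obtain B where B: "\<And>y. \<lbrakk>d \<le> y; y \<le> x\<rbrakk> \<Longrightarrow> norm (a y) \<le> B"
      using compact_imp_bounded by (fastforce simp: bounded_iff)
    have "norm (a y) \<le> max 1 B" if "0 < y" "y \<le> x" for y
      using d(2)[of y] B[of y] that by (cases "y < d") (auto intro: less_imp_le le_max_iff_disj[THEN iffD2])
    then show ?thesis using that by blast
  qed
  have A0: "0 \<le> A" using A[of x] x norm_ge_zero order_trans by blast
  \<comment> \<open>Replacing each \<open>k - \<sigma>\<close> by \<open>1 - \<sigma>\<close> keeps the factor \<open>1 / n!\<close>, which suffices for convergence to \<open>0\<close>.\<close>
  have iterate: "norm (a y) \<le> A * (1 / (1 - \<sigma>)) ^ n / fact n * y powr real n"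
    if "0 < y" "y \<le> x" for y n
    using that
  proof (induction n arbitrary: y)
    case 0
    then show ?case using A by simp
  next
    case (Suc n)
    define K where "K = A * (1 / (1 - \<sigma>)) ^ n / fact n"
    have K: "0 \<le> K" using A0 \<sigma> by (simp add: K_def)
    have IH: "norm (a u) \<le> K * u powr real n" if "0 < u" "u \<le> x" for u
      unfolding K_def using Suc.IH that by blast
    have b: "norm (b u) \<le> K / (real n + 1 - \<sigma>) * u powr (real n + 1 - \<sigma>)" if u: "0 < u" "u \<le> x" for u
    proof (rule norm_le_powr_of_derivative_bound[OF b' _ _ K lim(2) u])
      fix v :: real assume v: "0 < v" "v < x"
      have "norm (b' v) \<le> v powr (- \<sigma>) * (K * v powr real n)"
        using b'_bound[of v] IH[of v] v by (meson less_imp_le mult_left_mono order_trans powr_ge_zero)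
      also have "\<dots> = K * v powr (real n + 1 - \<sigma> - 1)"
        by (simp add: powr_add[symmetric] mult.left_commute add.commute)
      finally show "norm (b' v) \<le> K * v powr (real n + 1 - \<sigma> - 1)" .
    qed (use \<sigma> in auto)
    have "norm (a y) \<le> K / (real n + 1 - \<sigma>) / (real n + 1) * y powr (real n + 1)"
    proof (rule norm_le_powr_of_derivative_bound[OF a' _ _ _ lim(1) Suc.prems])
      fix v :: real assume v: "0 < v" "v < x"
      have "norm (a' v) \<le> v powr (\<sigma> - 1) * (K / (real n + 1 - \<sigma>) * v powr (real n + 1 - \<sigma>))"
        using a'_bound[of v] b[of v] v by (meson less_imp_le mult_left_mono order_trans powr_ge_zero)
      also have "\<dots> = K / (real n + 1 - \<sigma>) * (v powr (\<sigma> - 1) * v powr (real n + 1 - \<sigma>))"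
        by (simp only: mult_ac)
      also have "v powr (\<sigma> - 1) * v powr (real n + 1 - \<sigma>) = v powr (real n + 1 - 1)"
        by (simp add: powr_add[symmetric])
      finally show "norm (a' v) \<le> K / (real n + 1 - \<sigma>) * v powr (real n + 1 - 1)" .
    qed (use K \<sigma> in auto)
    also have "\<dots> \<le> K / (1 - \<sigma>) / (real n + 1) * y powr (real n + 1)"
      using K \<sigma> by (intro mult_right_mono divide_right_mono divide_left_mono) auto
    also have "K / (1 - \<sigma>) / (real n + 1) = A * (1 / (1 - \<sigma>)) ^ Suc n / fact (Suc n)"
      by (simp add: K_def add.commute mult_ac)
    also have "real n + 1 = real (Suc n)" by simp
    finally show ?case .
  qed
  have "(\<lambda>n. A * (1 / (1 - \<sigma>)) ^ n / fact n * x powr real n) \<longlonglongrightarrow> 0"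
  proof -
    have "(\<lambda>n. A * (inverse (fact n) * (x / (1 - \<sigma>)) ^ n)) \<longlonglongrightarrow> 0"
      by (intro tendsto_mult_right_zero summable_LIMSEQ_zero[OF summable_exp])
    then show ?thesis
      using x by (simp add: powr_realpow power_divide field_simps)
  qed
  then have "norm (a x) \<le> 0"
    by (rule LIMSEQ_le_const) (use iterate x in auto)
  then show ?thesis by simp
qed

text \<open>
  The derivative of \<open>D(s, -)\<close> is \<open>- D(s - 1, x)\<close>, which the symmetry rewrites as \<open>- x powr (s - 1) * D(1 - s, x)\<close>.
  Likewise the derivative of \<open>D(1 - s, -)\<close> is \<open>- x powr (- s) * D(s, x)\<close>, and the strip \<open>0 < Re s < 1\<close> is invariant
  under \<open>s \<mapsto> 1 - s\<close>. This closes the system.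
\<close>

lemma Macdonald_integral_eq_series_strip:
  assumes s: "0 < Re s" "Re s < 1" and c: "0 < c"
  shows "Macdonald_integral s c = Macdonald_series s c"
proof -
  have noint: "w \<notin> \<int>" if "0 < Re w" "Re w < 1" for w :: complex
    using that by (auto elim!: Ints_cases)
  let ?D = "\<lambda>s x. Macdonald_integral s x - Macdonald_series s x"
  have der: "(?D w has_vector_derivative - ?D (w - 1) x) (at x)" if "0 < x" for w x
    using has_vector_derivative_diff[OF has_vector_derivative_Macdonald_integral[OF that, of w]
        has_vector_derivative_Macdonald_series[OF that, of w]] by simp
  have sym: "?D w x = of_real x powr w * ?D (- w) x" if "0 < x" for w x
    using Macdonald_integral_symmetric[OF that, of w] Macdonald_series_symmetric[OF that, of w]
    by (simp add: right_diff_distrib)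
  have lim: "(?D w \<longlongrightarrow> 0) (at_right 0)" if "0 < Re w" "Re w < 1" for w
    using tendsto_diff[OF tendsto_Macdonald_integral_Gamma[OF that(1)]
      tendsto_Macdonald_series_Gamma[OF that(1) noint[OF that]]] by simp
  \<comment> \<open>The symmetry at orders \<open>s - 1\<close> and \<open>- s\<close> puts the two derivatives into the form of the system.\<close>
  have "?D s c = 0"
  proof (rule coupled_singular_system_trivial[OF s der der _ _ lim lim c])
    fix x :: real assume x: "0 < x"
    show "norm (- ?D (s - 1) x) \<le> x powr (Re s - 1) * norm (?D (1 - s) x)"
      using sym[OF x, of "s - 1"] x by (simp add: norm_mult norm_powr_of_real_pos)
    show "norm (- ?D (1 - s - 1) x) \<le> x powr (- Re s) * norm (?D s x)"
      using sym[OF x, of "- s"] x by (simp add: norm_mult norm_powr_of_real_pos)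
  qed (use s in auto)
  then show ?thesis by simp
qed

text \<open>
  An identity in \<open>c\<close> may be differentiated, and differentiation lowers the order by one.
\<close>

lemma Macdonald_integral_eq_series_left:
  assumes s: "Re s < 1" "Re s \<notin> \<int>" and c: "0 < c"
  shows "Macdonald_integral s c = Macdonald_series s c"
proof -
  have "Macdonald_integral (w - of_nat n) x = Macdonald_series (w - of_nat n) x"
    if w: "0 < Re w" "Re w < 1" and x: "0 < x" for w n x
    using x
  proof (induction n arbitrary: x)
    case 0
    then show ?case using Macdonald_integral_eq_series_strip[OF w] by simp
  next
    case (Suc n)
    let ?w = "w - of_nat n"
    have "(Macdonald_integral ?w has_vector_derivative - Macdonald_integral (?w - 1) x) (at x)"
      using Suc.prems by (rule has_vector_derivative_Macdonald_integral)
    then have "(Macdonald_series ?w has_vector_derivative - Macdonald_integral (?w - 1) x) (at x)"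
      by (rule has_vector_derivative_transform_within_open[of _ _ _ "{0<..}"])
        (use Suc in auto)
    then have "- Macdonald_integral (?w - 1) x = - Macdonald_series (?w - 1) x"
      using has_vector_derivative_Macdonald_series[OF Suc.prems, of ?w]
      by (rule vector_derivative_unique_at)
    then show ?case by (simp add: algebra_simps)
  qed
  note shift = this
  \<comment> \<open>Shifting by \<open>n\<close> moves \<open>s\<close> into the strip; \<open>n \<ge> 0\<close> because \<open>Re s < 1\<close>.\<close>
  define n where "n = nat (- \<lfloor>Re s\<rfloor>)"
  have n: "real n = - \<lfloor>Re s\<rfloor>"
    using s(1) by (simp add: n_def floor_le_iff)
  have "Re s \<noteq> \<lfloor>Re s\<rfloor>" using s(2) by (metis Ints_of_int)
  then have "0 < Re (s + of_nat n)" "Re (s + of_nat n) < 1"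
    using n of_int_floor_le[of "Re s"] real_of_int_floor_add_one_gt[of "Re s"]
    unfolding plus_complex.sel complex_Re_of_nat by linarith+
  from shift[OF this c, of n] show ?thesis by simp
qed

text \<open>
  The symmetry reaches \<open>Re s \<ge> 1\<close>. If \<open>Re s\<close> is an integer but \<open>s\<close> is not, then \<open>s\<close> is the limit of
  \<open>s + e\<close> for small \<open>e > 0\<close>, to which the previous cases apply, and both sides are continuous there.
\<close>

lemma Macdonald_integral_eq_series:
  assumes s: "s \<notin> \<int>" and c: "0 < c"
  shows "Macdonald_integral s c = Macdonald_series s c"
proof -
  have generic: "Macdonald_integral w c = Macdonald_series w c" if w: "Re w \<notin> \<int>" for w
  proof (cases "Re w < 1")
    case False
    then have "Macdonald_integral (- w) c = Macdonald_series (- w) c"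
      using w c by (intro Macdonald_integral_eq_series_left) auto
    then show ?thesis
      using Macdonald_integral_symmetric[OF c] Macdonald_series_symmetric[OF c] by metis
  qed (use w c Macdonald_integral_eq_series_left in auto)
  have near: "\<forall>\<^sub>F e in at_right 0. Re (s + of_real e) \<notin> \<int>"
  proof -
    have "Re (s + of_real e) \<notin> \<int>" if e: "0 < e" "e < 1 - frac (Re s)" for e
    proof
      assume "Re (s + of_real e) \<in> \<int>"
      then obtain k where k: "Re s + e = of_int k" by (auto elim!: Ints_cases)
      have "of_int \<lfloor>Re s\<rfloor> < (of_int k :: real)" "(of_int k :: real) < of_int \<lfloor>Re s\<rfloor> + 1"
        using k e of_int_floor_le[of "Re s"] unfolding frac_def by linarith+
      moreover from this(1) have "of_int \<lfloor>Re s\<rfloor> + 1 \<le> (of_int k :: real)"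
        by (simp add: int_less_real_le[symmetric])
      ultimately show False by linarith
    qed
    then show ?thesis
      using frac_lt_1[of "Re s"] by (auto simp: eventually_at_right_field intro!: exI[of _ "1 - frac (Re s)"])
  qed
  have path: "((\<lambda>e. s + of_real e) \<longlongrightarrow> s) (at_right (0::real))"
    by (auto intro!: tendsto_eq_intros)
  have "((\<lambda>e. Macdonald_integral (s + of_real e) c) \<longlongrightarrow> Macdonald_integral s c) (at_right (0::real))"
    using isCont_tendsto_compose[OF isCont_Macdonald_integral_order[OF c] path] .
  moreover have "((\<lambda>e. Macdonald_series (s + of_real e) c) \<longlongrightarrow> Macdonald_series s c) (at_right (0::real))"
    using isCont_tendsto_compose[OF isCont_Macdonald_series_order[OF s c] path] .
  then have "((\<lambda>e. Macdonald_integral (s + of_real e) c) \<longlongrightarrow> Macdonald_series s c) (at_right (0::real))"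
    by (rule Lim_transform_eventually) (use near generic in \<open>auto elim!: eventually_mono\<close>)
  ultimately show ?thesis
    by (rule tendsto_unique[rotated]) simp
qed

text \<open>
  At integer order \<open>K\<close> is a limit over nearby non-integer orders, at which it is already known to be a
  multiple of the Macdonald integral. That integral is continuous in the order without exception.
\<close>

theorem Macdonald_integral_eq_Bessel_K:
  assumes x: "0 < x"
  shows "Macdonald_integral s ((x / 2)\<^sup>2) = 2 * of_real (x / 2) powr s * Bessel_K s x"
proof -
  let ?p = "\<lambda>w. 2 * of_real (x / 2) powr w :: complex"
  have p: "?p w \<noteq> 0" for w using x by simp
  have nonint: "Bessel_K_nonint w x = Macdonald_integral w ((x / 2)\<^sup>2) / ?p w" if "w \<notin> \<int>" for w
    using Macdonald_integral_eq_series[OF that, of "(x / 2)\<^sup>2"]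
      Bessel_K_nonint_eq_Macdonald_series[OF x, of w] x p[of w] by (simp add: field_simps)
  show ?thesis
  proof (cases "s \<in> \<int>")
    case False
    then show ?thesis using nonint[OF False] p[of s] by (simp add: Bessel_K_def)
  next
    case True
    have "isCont ?p s"
      using has_field_derivative_powr_right[of "of_real (x / 2)"] DERIV_isCont x
      by (intro continuous_intros) auto
    then have "isCont (\<lambda>w. Macdonald_integral w ((x / 2)\<^sup>2) / ?p w) s"
      using x p by (intro continuous_divide isCont_Macdonald_integral_order) auto
    then have "((\<lambda>w. Macdonald_integral w ((x / 2)\<^sup>2) / ?p w) \<longlongrightarrow> Macdonald_integral s ((x / 2)\<^sup>2) / ?p s) (at s)"
      by (simp add: isCont_def)
    moreover have "\<forall>\<^sub>F w in at s. w \<notin> \<int>"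
    proof -
      have "w \<notin> \<int>" if "w \<noteq> s" "dist w s < 1" for w
      proof
        assume "w \<in> \<int>"
        then have "w - s \<in> \<int>" using True by simp
        then obtain k where k: "w - s = of_int k" by (auto elim!: Ints_cases)
        then have "\<bar>k\<bar> < 1" using that by (simp add: dist_norm)
        then show False using k that by simp
      qed
      then show ?thesis by (auto simp: eventually_at intro!: exI[of _ 1])
    qed
    ultimately have "((\<lambda>w. Bessel_K_nonint w x) \<longlongrightarrow> Macdonald_integral s ((x / 2)\<^sup>2) / ?p s) (at s)"
      by (elim Lim_transform_eventually) (auto elim!: eventually_mono simp: nonint)
    then have "Bessel_K s x = Macdonald_integral s ((x / 2)\<^sup>2) / ?p s"
      using True by (simp add: Bessel_K_def tendsto_Lim)
    then show ?thesis using p[of s] by simp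
  qed
qed

section \<open>Inner integrals of the iterated transforms\<close>

lemma borel_measurable_pos_fst [measurable]: "fst \<in> borel_measurable (pos \<Otimes>\<^sub>M pos)"
  using measurable_compose[OF measurable_fst borel_measurable_pos_id] by simp

lemma borel_measurable_pos_snd [measurable]: "snd \<in> borel_measurable (pos \<Otimes>\<^sub>M pos)"
  using measurable_compose[OF measurable_snd borel_measurable_pos_id] by simp

text \<open>
  Up to an explicit factor \<open>K\<close> is a parameter integral, which Fubini makes measurable at every order alike.
\<close>

lemma borel_measurable_Bessel_K_scaled:
  assumes z: "0 < z"
  shows "(\<lambda>x. Bessel_K s (x * z)) \<in> borel_measurable pos"
proof -
  have "Bessel_K s (x * z) = Macdonald_integral s ((x * z / 2)\<^sup>2) / (2 * of_real (x * z / 2) powr s)"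
    if "x \<in> space pos" for x
    using Macdonald_integral_eq_Bessel_K[of "x * z" s] that z by simp
  moreover have "(\<lambda>x. Macdonald_integral s ((x * z / 2)\<^sup>2) / (2 * of_real (x * z / 2) powr s)) \<in> borel_measurable pos"
    unfolding Macdonald_integral_def by measurable
  ultimately show ?thesis
    by (subst measurable_cong) auto
qed

text \<open>
  Under \<open>t = (x/2)\<^sup>2 / y\<^sup>2\<close> the exponent \<open>- t - c / t\<close> with \<open>c = (x z / 2)\<^sup>2\<close> becomes
  \<open>- (x / (2 y))\<^sup>2 - y\<^sup>2 z\<^sup>2\<close>.
\<close>

lemma integral_L2_L2_kernel:
  assumes x: "0 < x" and z: "0 < z"
  shows "(\<integral>y. of_real (y * exp (- (y\<^sup>2 * z\<^sup>2))) * (of_real y powr (- 2 * w - 2) *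
      of_real (exp (- (x\<^sup>2 * (1 / (2 * y))\<^sup>2)))) \<partial>pos) =
    of_real (x / 2) powr (- w) * of_real z powr w * Bessel_K w (x * z)"
proof -
  define a where "a = (x / 2)\<^sup>2"
  define c where "c = (x * z / 2)\<^sup>2"
  have a: "0 < a" and c: "0 < c" using x z by (auto simp: a_def c_def)
  let ?I = "\<lambda>y. of_real (y * exp (- (y\<^sup>2 * z\<^sup>2))) * (of_real y powr (- 2 * w - 2) *
      complex_of_real (exp (- (x\<^sup>2 * (1 / (2 * y))\<^sup>2))))"
  have substitution: "of_real (a * \<bar>-2\<bar> * y powr (-2 - 1)) * Macdonald_kernel w c (a * y powr -2) =
      2 * of_real a powr w * ?I y" if "y \<in> space pos" for y
  proof -
    have y: "0 < y" using that by simp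
    have "- (a * y powr -2) - c / (a * y powr -2) = - (y\<^sup>2 * z\<^sup>2) + - (x\<^sup>2 * (1 / (2 * y))\<^sup>2)"
      using x y by (simp add: a_def c_def powr_minus field_simps power2_eq_square)
    then have E: "exp (- (a * y powr -2) - c / (a * y powr -2)) = exp (- (y\<^sup>2 * z\<^sup>2)) * exp (- (x\<^sup>2 * (1 / (2 * y))\<^sup>2))"
      by (simp only: exp_add)
    have "of_real (a * y powr -2) powr (w - 1) = of_real a powr (w - 1) * complex_of_real y powr (of_real (-2) * (w - 1))"
      unfolding powr_powr_of_real_pos[OF y, symmetric] using a y by (intro powr_mult_of_real_pos) auto
    moreover have "complex_of_real a * of_real a powr (w - 1) = of_real a powr w"
      using a by (simp add: powr_diff)
    moreover have "complex_of_real (y powr (-2 - 1)) * of_real y powr (of_real (-2) * (w - 1)) =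
        of_real y * of_real y powr (- 2 * w - 2)"
    proof -
      have "complex_of_real (y powr (-2 - 1)) = of_real y powr (of_real (-3))"
        using y powr_of_real[of y "-3"] by simp
      moreover have "of_real y * of_real y powr (- 2 * w - 2) = complex_of_real y powr (- 1 - 2 * w)"
        using y powr_add[of "complex_of_real y" 1 "- 2 * w - 2"] by simp
      ultimately show ?thesis
        by (simp add: powr_add[symmetric] algebra_simps)
    qed
    ultimately show ?thesis
      unfolding Macdonald_kernel_def E by (simp add: mult_ac)
  qed
  have "2 * of_real a powr w * (\<integral>y. ?I y \<partial>pos) = (\<integral>y. 2 * of_real a powr w * ?I y \<partial>pos)"
    by (rule integral_mult_right_zero[symmetric])
  also have "\<dots> = (\<integral>y. of_real (a * \<bar>-2\<bar> * y powr (-2 - 1)) * Macdonald_kernel w c (a * y powr -2) \<partial>pos)"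
    by (rule Bochner_Integration.integral_cong[OF refl substitution[symmetric]])
  also have "\<dots> = Macdonald_integral w c"
    unfolding Macdonald_integral_def
    by (rule integral_power_substitution[OF integrable_Macdonald_kernel[OF c] a]) simp
  also have "\<dots> = 2 * of_real (x * z / 2) powr w * Bessel_K w (x * z)"
    unfolding c_def using x z by (intro Macdonald_integral_eq_Bessel_K) simp
  also have "complex_of_real (x * z / 2) powr w = of_real (x / 2) powr w * of_real z powr w"
    using powr_mult_of_real_pos[of "x / 2" z w] x z by simp
  finally have *: "of_real a powr w * (\<integral>y. ?I y \<partial>pos) = of_real (x / 2) powr w * of_real z powr w * Bessel_K w (x * z)"
    by simp
  have "complex_of_real a powr w = of_real (x / 2) powr w * of_real (x / 2) powr w"
    using powr_mult_of_real_pos[of "x / 2" "x / 2" w] x by (simp add: a_def power2_eq_square)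
  with * have "of_real (x / 2) powr w * (\<integral>y. ?I y \<partial>pos) = of_real z powr w * Bessel_K w (x * z)"
    using x by (simp add: mult_ac del: of_real_divide)
  then show ?thesis
    using x by (simp add: powr_minus field_simps del: of_real_divide)
qed

text \<open>
  Raising \<open>m\<close> by one multiplies the product by \<open>(m + Re s) / norm (m + s) \<le> 1\<close>. This controls the terms of the
  Bessel series after each has been replaced by its absolute value and integrated.
\<close>

lemma norm_rGamma_times_Gamma_Re_le:
  assumes s: "0 < Re s"
  shows "norm (rGamma (of_nat m + s)) * norm (Gamma (complex_of_real (real m + Re s))) \<le>
    norm (rGamma s) * norm (Gamma (complex_of_real (Re s)))"
proof (induction m)
  case (Suc m)
  let ?r = "complex_of_real (real m + Re s)"
  have "?r \<notin> \<int>\<^sub>\<le>\<^sub>0"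
    using s by (auto elim!: nonpos_Ints_cases simp: complex_eq_iff)
  then have "Gamma (?r + 1) = ?r * Gamma ?r" by (rule Gamma_plus1)
  then have "norm (rGamma (of_nat (Suc m) + s)) * norm (Gamma (complex_of_real (real (Suc m) + Re s))) =
      norm (rGamma (of_nat (Suc m) + s)) * (norm ?r * norm (Gamma ?r))"
    by (simp add: norm_mult[symmetric] add_ac)
  also have "norm ?r \<le> norm (of_nat m + s)"
    using s complex_Re_le_cmod[of "of_nat m + s"] by (simp only: norm_of_real) simp
  then have "norm (rGamma (of_nat (Suc m) + s)) * (norm ?r * norm (Gamma ?r)) \<le>
      norm (rGamma (of_nat (Suc m) + s)) * (norm (of_nat m + s) * norm (Gamma ?r))"
    by (intro mult_left_mono mult_right_mono) auto
  also have "\<dots> = norm ((of_nat m + s) * rGamma (of_nat m + s + 1)) * norm (Gamma ?r)"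
    by (simp add: norm_mult add_ac)
  also have "\<dots> = norm (rGamma (of_nat m + s)) * norm (Gamma ?r)"
    by (simp only: rGamma_plus1)
  also note Suc.IH
  finally show ?case .
qed simp

lemma integral_norm_Gamma_exp:
  assumes s: "0 < Re s" and a: "0 < a"
  shows "(\<integral>t. norm (of_real t powr (s - 1) * complex_of_real (exp (- (a * t)))) \<partial>pos) =
    norm (Gamma (complex_of_real (Re s))) * a powr (- Re s)"
proof -
  let ?r = "complex_of_real (Re s)"
  have "complex_of_real (\<integral>t. norm (of_real t powr (s - 1) * complex_of_real (exp (- (a * t)))) \<partial>pos) =
      (\<integral>t. of_real (norm (of_real t powr (s - 1) * complex_of_real (exp (- (a * t))))) \<partial>pos)"
    by simp
  also have "\<dots> = (\<integral>t. of_real t powr (?r - 1) * of_real (exp (- (a * t))) \<partial>pos)"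
    by (rule Bochner_Integration.integral_cong) (auto simp: norm_mult norm_powr_of_real_pos powr_of_real[symmetric])
  also have "\<dots> = Gamma ?r * of_real a powr (- ?r)"
    using s a by (intro integral_Gamma_exp) auto
  finally have "norm (complex_of_real (\<integral>t. norm (of_real t powr (s - 1) * complex_of_real (exp (- (a * t)))) \<partial>pos)) =
      norm (Gamma ?r * of_real a powr (- ?r))"
    by (rule arg_cong)
  then show ?thesis
    using a by (simp add: norm_mult norm_powr_of_real_pos integral_nonneg)
qed

lemma integral_norm_Gamma_Gaussian:
  assumes s: "0 < Re s" and a: "0 < a"
  shows "(\<integral>u. norm (of_real u powr (2 * s - 1) * complex_of_real (exp (- (a * u\<^sup>2)))) \<partial>pos) =
    norm (Gamma (complex_of_real (Re s))) * a powr (- Re s) / 2"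
proof -
  let ?r = "complex_of_real (Re s)"
  have "complex_of_real (\<integral>u. norm (of_real u powr (2 * s - 1) * complex_of_real (exp (- (a * u\<^sup>2)))) \<partial>pos) =
      (\<integral>u. of_real (norm (of_real u powr (2 * s - 1) * complex_of_real (exp (- (a * u\<^sup>2))))) \<partial>pos)"
    by simp
  also have "\<dots> = (\<integral>u. of_real u powr (2 * ?r - 1) * of_real (exp (- (a * u\<^sup>2))) \<partial>pos)"
    by (rule Bochner_Integration.integral_cong) (auto simp: norm_mult norm_powr_of_real_pos powr_of_real[symmetric])
  also have "\<dots> = Gamma ?r * of_real a powr (- ?r) / 2"
    using s a by (intro integral_Gamma_Gaussian) auto
  finally have "norm (complex_of_real (\<integral>u. norm (of_real u powr (2 * s - 1) * complex_of_real (exp (- (a * u\<^sup>2)))) \<partial>pos)) =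
      norm (Gamma ?r * of_real a powr (- ?r) / 2)"
    by (rule arg_cong)
  then show ?thesis
    using a by (simp add: norm_mult norm_divide norm_powr_of_real_pos integral_nonneg)
qed

text \<open>
  Weber's first exponential integral. The \<open>m\<close>-th term of the series integrates to a Gamma integral whose
  value cancels the coefficient \<open>rGamma (m + \<mu> + 1)\<close>, and what remains is the exponential series. The
  exchange of sum and integral is legitimate because the integrals of the absolute values
  are dominated by an exponential series as well.
\<close>

lemma integral_Bessel_J_Gaussian:
  assumes \<mu>: "-1 < Re \<mu>" and t: "0 < t" and z: "0 < z"
  shows "(\<integral>u. Bessel_J \<mu> (u * z) * of_real u powr (\<mu> + 1) * of_real (exp (- (t * u\<^sup>2))) \<partial>pos) =
    of_real (z / 2) powr \<mu> * of_real t powr (- \<mu> - 1) / 2 * of_real (exp (- ((z / 2)\<^sup>2 / t)))"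
proof -
  define q where "q = (z / 2)\<^sup>2"
  have q: "0 \<le> q" by (simp add: q_def)
  define s where "s m = of_nat m + (\<mu> + 1)" for m
  have s: "0 < Re (s m)" for m using \<mu> by (simp add: s_def)
  let ?e = "\<lambda>m u. of_real u powr (2 * s m - 1) * complex_of_real (exp (- (t * u\<^sup>2)))"
  define h where "h m u = of_real (z / 2) powr \<mu> * ((- 1) ^ m * rGamma (s m) / fact m * of_real q ^ m) * ?e m u" for m u
  have int: "integrable pos (h m)" for m
    unfolding h_def by (intro integrable_mult_right integrable_Gamma_Gaussian s t)
  have norm_int: "(\<integral>u. norm (h m u) \<partial>pos) =
      norm (complex_of_real (z / 2) powr \<mu>) * (norm (rGamma (s m)) / fact m * q ^ m) *
      (norm (Gamma (complex_of_real (Re (s m)))) * t powr (- Re (s m)) / 2)" for m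
    unfolding h_def norm_mult[of _ "?e m _"] integral_mult_right_zero integral_norm_Gamma_Gaussian[OF s t]
    using z by (simp add: norm_mult norm_divide norm_power q_def[symmetric] q)
  have val: "(\<integral>u. h m u \<partial>pos) = of_real (z / 2) powr \<mu> * of_real t powr (- \<mu> - 1) / 2 *
      ((- of_real (q / t)) ^ m / fact m)" for m
  proof -
    have "s m \<notin> \<int>\<^sub>\<le>\<^sub>0" using s[of m] by (auto elim!: nonpos_Ints_cases)
    then have G: "rGamma (s m) * Gamma (s m) = 1"
      by (simp add: Gamma_def rGamma_eq_zero_iff)
    have P: "complex_of_real t powr (- s m) = of_real t powr (- \<mu> - 1) / of_real t ^ m"
    proof -
      have "- s m = (- \<mu> - 1) - of_nat m" by (simp add: s_def)
      then show ?thesis using t by (simp only: powr_diff) simp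
    qed
    have "(\<integral>u. h m u \<partial>pos) = of_real (z / 2) powr \<mu> * ((- 1) ^ m * rGamma (s m) / fact m * of_real q ^ m) *
        (Gamma (s m) * of_real t powr (- s m) / 2)"
      unfolding h_def integral_mult_right_zero integral_Gamma_Gaussian[OF s t] ..
    also have "\<dots> = (rGamma (s m) * Gamma (s m)) * (of_real (z / 2) powr \<mu> * of_real t powr (- s m) / 2 *
        ((- 1) ^ m * of_real q ^ m / fact m))"
      by (simp add: mult_ac)
    also have "\<dots> = of_real (z / 2) powr \<mu> * of_real t powr (- \<mu> - 1) / 2 *
        (((- 1) ^ m * of_real q ^ m / of_real t ^ m) / fact m)"
      unfolding G P by (simp add: mult_ac)
    also have "(- 1) ^ m * complex_of_real q ^ m / of_real t ^ m = (- of_real (q / t)) ^ m"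
      by (subst (2) power_minus) (simp add: power_divide)
    finally show ?thesis .
  qed
  have J: "Bessel_J \<mu> (u * z) * of_real u powr (\<mu> + 1) * of_real (exp (- (t * u\<^sup>2))) = (\<Sum>m. h m u)"
    and summable_h: "summable (\<lambda>m. norm (h m u))" if "u \<in> space pos" for u
  proof -
    have u: "0 < u" using that by simp
    let ?w = "- complex_of_real ((u * z / 2)\<^sup>2)"
    have "(u * z / 2)\<^sup>2 = u\<^sup>2 * q" by (simp add: q_def power_mult_distrib power_divide)
    then have wpow: "?w ^ m = (-1) ^ m * of_real q ^ m * of_real u ^ (2 * m)" for m
      by (subst power_minus) (simp add: power_mult_distrib power_mult)
    have upow: "of_real u powr \<mu> * of_real u powr (\<mu> + 1) * of_real u ^ (2 * m) = complex_of_real u powr (2 * s m - 1)" for m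
    proof -
      have "complex_of_real u ^ (2 * m) = of_real u powr (of_nat (2 * m))"
        using u by (simp only: powr_complexpow of_real_eq_0_iff)
      then show ?thesis
        by (simp add: powr_add[symmetric] s_def algebra_simps)
    qed
    have Z: "complex_of_real (u * z / 2) powr \<mu> = of_real u powr \<mu> * of_real (z / 2) powr \<mu>"
      using powr_mult_of_real_pos[of u "z/2" \<mu>] u z by simp
    have h_eq: "h m u = (of_real (u * z / 2) powr \<mu> * of_real u powr (\<mu> + 1) * of_real (exp (- (t * u\<^sup>2)))) *
        (rGamma (of_nat m + \<mu> + 1) / fact m * ?w ^ m)" for m
      unfolding h_def upow[symmetric] wpow Z by (simp add: s_def add_ac mult_ac)
    show "Bessel_J \<mu> (u * z) * of_real u powr (\<mu> + 1) * of_real (exp (- (t * u\<^sup>2))) = (\<Sum>m. h m u)"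
      unfolding h_eq Bessel_J_eq_series Bessel_series_def
      by (subst suminf_mult[OF summable_Bessel_series]) (simp only: mult_ac)
    show "summable (\<lambda>m. norm (h m u))"
    proof -
      obtain B where B: "\<And>m. norm (rGamma (of_nat m + (\<mu> + 1))) \<le> B"
        by (metis rGamma_shift_bounded_on_compact[of "{\<mu> + 1}"] compact_sing singletonI)
      have "norm (rGamma (of_nat m + \<mu> + 1) / fact m * ?w ^ m) \<le> B / fact m * norm ?w ^ m" for m
        using B[of m] by (intro norm_Bessel_series_term_le) (simp only: add.assoc)
      then have "summable (\<lambda>m. norm (rGamma (of_nat m + \<mu> + 1) / fact m * ?w ^ m))"
        by (intro summable_comparison_test'[OF summable_exp_bound[of B "norm ?w"]]) simp
      then show ?thesis
        unfolding h_eq norm_mult[of "of_real (u * z / 2) powr \<mu> * of_real u powr (\<mu> + 1) * of_real (exp (- (t * u\<^sup>2)))"]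
        by (rule summable_mult)
    qed
  qed
  have summable_int: "summable (\<lambda>m. \<integral>u. norm (h m u) \<partial>pos)"
  proof (rule summable_comparison_test')
    define C where "C = norm (complex_of_real (z / 2) powr \<mu>) * (norm (rGamma (\<mu> + 1)) *
        norm (Gamma (complex_of_real (Re (\<mu> + 1))))) * t powr (- Re (\<mu> + 1)) / 2"
    show "summable (\<lambda>m. C / fact m * (q / t) ^ m)" by (rule summable_exp_bound)
    fix m
    have r: "Re (s m) = real m + Re (\<mu> + 1)" by (simp add: s_def)
    have P: "t powr (- Re (s m)) = t powr (- Re (\<mu> + 1)) / t ^ m"
      using t unfolding r by (simp add: powr_diff powr_realpow[symmetric] powr_minus powr_add field_simps)
    have "norm (rGamma (s m)) * norm (Gamma (complex_of_real (Re (s m)))) \<le>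
        norm (rGamma (\<mu> + 1)) * norm (Gamma (complex_of_real (Re (\<mu> + 1))))"
      unfolding r unfolding s_def using \<mu> by (intro norm_rGamma_times_Gamma_Re_le) simp
    then have "(norm (complex_of_real (z / 2) powr \<mu>) * t powr (- Re (\<mu> + 1)) / 2 * (q ^ m / t ^ m / fact m)) *
        (norm (rGamma (s m)) * norm (Gamma (complex_of_real (Re (s m))))) \<le>
      (norm (complex_of_real (z / 2) powr \<mu>) * t powr (- Re (\<mu> + 1)) / 2 * (q ^ m / t ^ m / fact m)) *
        (norm (rGamma (\<mu> + 1)) * norm (Gamma (complex_of_real (Re (\<mu> + 1)))))"
      using t by (intro mult_left_mono) (auto simp: q_def)
    then have "(\<integral>u. norm (h m u) \<partial>pos) \<le> C / fact m * (q / t) ^ m"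
      unfolding norm_int P C_def by (simp add: power_divide mult_ac)
    then show "norm (\<integral>u. norm (h m u) \<partial>pos) \<le> C / fact m * (q / t) ^ m"
      by (simp add: integral_nonneg)
  qed
  have "(\<integral>u. Bessel_J \<mu> (u * z) * of_real u powr (\<mu> + 1) * of_real (exp (- (t * u\<^sup>2))) \<partial>pos) =
      (\<integral>u. (\<Sum>m. h m u) \<partial>pos)"
    by (rule Bochner_Integration.integral_cong[OF refl J])
  also have "\<dots> = (\<Sum>m. \<integral>u. h m u \<partial>pos)"
    by (rule integral_suminf[OF int AE_I2 summable_int]) (rule summable_h)
  also have "\<dots> = of_real (z / 2) powr \<mu> * of_real t powr (- \<mu> - 1) / 2 * (\<Sum>m. (- of_real (q / t)) ^ m / fact m)"
    unfolding val using summable_exp_generic[of "- complex_of_real (q / t)"]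
    by (intro suminf_mult) (simp add: scaleR_conv_of_real divide_inverse mult.commute)
  also have "(\<Sum>m. (- complex_of_real (q / t)) ^ m / fact m) = exp (- of_real (q / t))"
    by (simp add: exp_def scaleR_conv_of_real divide_inverse mult.commute)
  also have "\<dots> = of_real (exp (- (q / t)))"
    by (simp only: exp_of_real[symmetric] of_real_minus)
  finally show ?thesis by (simp add: q_def)
qed

section \<open>The three transform identities\<close>

text \<open>
  The power \<open>(x\<^sup>2 + u\<^sup>2) powr (- \<nu>)\<close> is a Gamma integral over \<open>t\<close>. Its absolute version has
  the same shape with \<open>Re \<nu>\<close>, so absolute integrability in \<open>u\<close> alone gives joint integrability. After the exchange the
  inner integral is \<open>integral_Bessel_J_Gaussian\<close>, and the outer one is a Macdonald integral up to
  the dilation \<open>t \<mapsto> x\<^sup>2 t\<close>.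
\<close>

lemma integral_Bessel_J_powr:
  assumes \<mu>: "-1 < Re \<mu>" and \<nu>: "0 < Re \<nu>" and x: "0 < x" and z: "0 < z"
    and int: "integrable pos (\<lambda>u. Bessel_J \<mu> (u * z) * of_real u powr (\<mu> + 1) / of_real (x\<^sup>2 + u\<^sup>2) powr \<nu>)"
  shows "(\<integral>u. Bessel_J \<mu> (u * z) * of_real u powr (\<mu> + 1) / of_real (x\<^sup>2 + u\<^sup>2) powr \<nu> \<partial>pos) =
    rGamma \<nu> * of_real (z / 2) powr (\<nu> - 1) * of_real x powr (\<mu> + 1 - \<nu>) * Bessel_K (\<nu> - \<mu> - 1) (x * z)"
proof -
  define w where "w = \<nu> - \<mu> - 1"
  define c where "c = (x * z / 2)\<^sup>2"
  have c: "0 < c" using x z by (simp add: c_def)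
  let ?g = "\<lambda>u. Bessel_J \<mu> (u * z) * of_real u powr (\<mu> + 1)"
  let ?p = "\<lambda>u. of_real (x\<^sup>2 + u\<^sup>2) powr \<nu>"
  let ?e = "\<lambda>u t. of_real t powr (\<nu> - 1) * complex_of_real (exp (- ((x\<^sup>2 + u\<^sup>2) * t)))"
  have pos_sum: "0 < x\<^sup>2 + u\<^sup>2" for u using x by (simp add: add_pos_nonneg)
  have inner_t: "(\<integral>t. ?g u * ?e u t \<partial>pos) = Gamma \<nu> * (?g u / ?p u)" for u
    unfolding integral_mult_right_zero integral_Gamma_exp[OF \<nu> pos_sum]
    by (simp only: powr_minus divide_inverse mult_ac)
  have joint: "integrable (pos \<Otimes>\<^sub>M pos) (\<lambda>(u, t). ?g u * ?e u t)"
  proof (rule pos2.Fubini_integrable)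
    show "(\<lambda>(u, t). ?g u * ?e u t) \<in> borel_measurable (pos \<Otimes>\<^sub>M pos)"
      by (simp add: case_prod_beta')
    have "(\<integral>t. norm (?g u * ?e u t) \<partial>pos) = norm (Gamma (complex_of_real (Re \<nu>))) * norm (?g u / ?p u)" for u
      unfolding norm_mult[of "?g u"] integral_mult_right_zero integral_norm_Gamma_exp[OF \<nu> pos_sum]
        norm_divide norm_powr_of_real_pos[OF pos_sum]
      by (simp only: powr_minus divide_inverse mult_ac)
    then show "integrable pos (\<lambda>u. \<integral>t. norm (case (u, t) of (u, t) \<Rightarrow> ?g u * ?e u t) \<partial>pos)"
      using integrable_norm[OF int] by simp
    show "AE u in pos. integrable pos (\<lambda>t. case (u, t) of (u, t) \<Rightarrow> ?g u * ?e u t)"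
      unfolding prod.case by (intro AE_I2 integrable_mult_right integrable_Gamma_exp \<nu> pos_sum)
  qed
  have inner_u: "(\<integral>u. ?g u * ?e u t \<partial>pos) =
      of_real (z / 2) powr \<mu> / 2 * (of_real x powr (- 2 * w) * (of_real (x\<^sup>2 * \<bar>1\<bar> * t powr (1 - 1)) * Macdonald_kernel w c (x\<^sup>2 * t powr 1)))"
    if "t \<in> space pos" for t
  proof -
    have t: "0 < t" using that by simp
    have "?g u * ?e u t = of_real t powr (\<nu> - 1) * of_real (exp (- (x\<^sup>2 * t))) * (?g u * of_real (exp (- (t * u\<^sup>2))))" for u
    proof -
      have "exp (- ((x\<^sup>2 + u\<^sup>2) * t)) = exp (- (x\<^sup>2 * t)) * exp (- (t * u\<^sup>2))"
        by (simp add: exp_add[symmetric] algebra_simps)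
      then show ?thesis by simp
    qed
    then have "(\<integral>u. ?g u * ?e u t \<partial>pos) = of_real t powr (\<nu> - 1) * of_real (exp (- (x\<^sup>2 * t))) *
        (of_real (z / 2) powr \<mu> * of_real t powr (- \<mu> - 1) / 2 * of_real (exp (- ((z / 2)\<^sup>2 / t))))"
      by (simp only: integral_mult_right_zero integral_Bessel_J_Gaussian[OF \<mu> t z])
    also have "\<dots> = of_real (z / 2) powr \<mu> / 2 * ((of_real t powr (\<nu> - 1) * of_real t powr (- \<mu> - 1)) *
        (of_real (exp (- (x\<^sup>2 * t))) * of_real (exp (- ((z / 2)\<^sup>2 / t)))))"
      by (simp only: mult_ac times_divide_eq_left times_divide_eq_right)
    also have "of_real t powr (\<nu> - 1) * complex_of_real t powr (- \<mu> - 1) = of_real t powr (w - 1)"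
      by (simp add: powr_add[symmetric] w_def algebra_simps)
    also have "complex_of_real (exp (- (x\<^sup>2 * t))) * of_real (exp (- ((z / 2)\<^sup>2 / t))) =
        of_real (exp (- (x\<^sup>2 * t) - c / (x\<^sup>2 * t)))"
      using x t by (simp add: c_def exp_add[symmetric] power_mult_distrib power_divide flip: of_real_mult)
    also have "of_real t powr (w - 1) * of_real (exp (- (x\<^sup>2 * t) - c / (x\<^sup>2 * t))) =
        of_real x powr (- 2 * w) * (of_real (x\<^sup>2 * \<bar>1\<bar> * t powr (1 - 1)) * Macdonald_kernel w c (x\<^sup>2 * t powr 1))"
    proof -
      have "complex_of_real (x\<^sup>2 * t) powr (w - 1) = of_real (x\<^sup>2) powr (w - 1) * of_real t powr (w - 1)"
        using x t by (intro powr_mult_of_real_pos) auto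
      also have "complex_of_real (x\<^sup>2) powr (w - 1) = of_real x powr (2 * (w - 1))"
        using powr_powr_of_real_pos[OF x, of 2 "w - 1"] x by simp
      finally have "of_real x powr (- 2 * w) * (of_real (x\<^sup>2) * complex_of_real (x\<^sup>2 * t) powr (w - 1)) =
          (of_real x powr (- 2 * w) * of_real x powr 2 * of_real x powr (2 * (w - 1))) * of_real t powr (w - 1)"
        using x by (simp add: mult_ac)
      also have "of_real x powr (- 2 * w) * of_real x powr 2 * complex_of_real x powr (2 * (w - 1)) = 1"
        using x by (simp only: powr_add[symmetric]) (simp add: algebra_simps)
      finally show ?thesis
        using t by (simp add: Macdonald_kernel_def mult_ac)
    qed
    finally show ?thesis .
  qed
  have "Gamma \<nu> * (\<integral>u. ?g u / ?p u \<partial>pos) = (\<integral>u. (\<integral>t. ?g u * ?e u t \<partial>pos) \<partial>pos)"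
    unfolding inner_t by (rule integral_mult_right_zero[symmetric])
  also have "\<dots> = (\<integral>t. (\<integral>u. ?g u * ?e u t \<partial>pos) \<partial>pos)"
    by (rule pos2.Fubini_integral[OF joint, symmetric])
  also have "\<dots> = (\<integral>t. of_real (z / 2) powr \<mu> / 2 * (of_real x powr (- 2 * w) * (of_real (x\<^sup>2 * \<bar>1\<bar> * t powr (1 - 1)) * Macdonald_kernel w c (x\<^sup>2 * t powr 1))) \<partial>pos)"
    by (rule Bochner_Integration.integral_cong[OF refl inner_u])
  also have "\<dots> = of_real (z / 2) powr \<mu> / 2 * (of_real x powr (- 2 * w) * Macdonald_integral w c)"
    unfolding Macdonald_integral_def integral_mult_right_zero
    using integral_power_substitution[OF integrable_Macdonald_kernel[OF c] _ one_neq_zero, of "x\<^sup>2" w] x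
    by simp
  also have "Macdonald_integral w c = 2 * of_real (x * z / 2) powr w * Bessel_K w (x * z)"
    unfolding c_def using x z by (intro Macdonald_integral_eq_Bessel_K) simp
  also have "complex_of_real (x * z / 2) powr w = of_real x powr w * of_real (z / 2) powr w"
    using powr_mult_of_real_pos[of x "z / 2" w] x z by simp
  also have "of_real (z / 2) powr \<mu> / 2 * (of_real x powr (- 2 * w) * (2 * (of_real x powr w * of_real (z / 2) powr w) * Bessel_K w (x * z))) =
      (of_real (z / 2) powr \<mu> * of_real (z / 2) powr w) * (of_real x powr (- 2 * w) * of_real x powr w) * Bessel_K w (x * z)"
    by (simp add: mult_ac)
  also have "complex_of_real (z / 2) powr \<mu> * of_real (z / 2) powr w = of_real (z / 2) powr (\<nu> - 1)"
    by (simp only: powr_add[symmetric]) (simp add: w_def)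
  also have "complex_of_real x powr (- 2 * w) * of_real x powr w = of_real x powr (\<mu> + 1 - \<nu>)"
    by (simp only: powr_add[symmetric]) (simp add: w_def algebra_simps)
  finally have "Gamma \<nu> * (\<integral>u. ?g u / ?p u \<partial>pos) =
      of_real (z / 2) powr (\<nu> - 1) * of_real x powr (\<mu> + 1 - \<nu>) * Bessel_K w (x * z)" .
  note product = this
  have unit: "rGamma \<nu> * Gamma \<nu> = 1"
  proof -
    have "\<nu> \<notin> \<int>\<^sub>\<le>\<^sub>0" using \<nu> by (auto elim!: nonpos_Ints_cases)
    then show ?thesis by (simp add: Gamma_def rGamma_eq_zero_iff)
  qed
  have "(\<integral>u. ?g u / ?p u \<partial>pos) = rGamma \<nu> * (Gamma \<nu> * (\<integral>u. ?g u / ?p u \<partial>pos))"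
    by (simp only: mult.assoc[symmetric] unit mult_1_left)
  then show ?thesis
    unfolding product by (simp only: w_def mult.assoc)
qed

lemma L2_L2_transform_eq:
  assumes z: "0 < z"
    and f [measurable]: "f \<in> borel_measurable pos"
    and conv: "abs_convergent_iterated (\<lambda>y x.
           of_real (y * exp (- (y\<^sup>2 * z\<^sup>2))) * (of_real y powr (- 2 * w - 2) *
             (of_real (x * exp (- (x\<^sup>2 * (1 / (2 * y))\<^sup>2))) * f x)))"
  shows "L2_transform (\<lambda>y. of_real y powr (- 2 * w - 2) * L2_transform f (1 / (2 * y))) z =
    of_real (2 * z) powr w * (\<integral>x. of_real x powr (1 - w) * Bessel_K w (x * z) * f x \<partial>pos)"
proof -
  let ?k = "\<lambda>y x. of_real (y * exp (- (y\<^sup>2 * z\<^sup>2))) * (of_real y powr (- 2 * w - 2) *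
      (of_real (x * exp (- (x\<^sup>2 * (1 / (2 * y))\<^sup>2))) * f x))"
  have joint: "integrable (pos \<Otimes>\<^sub>M pos) (\<lambda>(y, x). ?k y x)"
    by (rule integrable_of_abs_convergent_iterated[OF _ conv]) (simp add: case_prod_beta')
  have inner: "(\<integral>y. ?k y x \<partial>pos) =
      of_real (2 * z) powr w * (of_real x powr (1 - w) * Bessel_K w (x * z) * f x)" if "x \<in> space pos" for x
  proof -
    have x: "0 < x" using that by simp
    have "(\<integral>y. ?k y x \<partial>pos) = (\<integral>y. (of_real x * f x) * (of_real (y * exp (- (y\<^sup>2 * z\<^sup>2))) * (of_real y powr (- 2 * w - 2) *
        of_real (exp (- (x\<^sup>2 * (1 / (2 * y))\<^sup>2))))) \<partial>pos)"
      by (rule Bochner_Integration.integral_cong) (simp_all add: mult_ac)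
    also have "\<dots> = of_real x * f x * (of_real (x / 2) powr (- w) * of_real z powr w * Bessel_K w (x * z))"
      unfolding integral_mult_right_zero integral_L2_L2_kernel[OF x z] ..
    also have "complex_of_real (x / 2) powr (- w) = of_real x powr (- w) * of_real 2 powr w"
    proof -
      have "complex_of_real (1 / 2) powr (- w) = of_real 2 powr w"
        using powr_of_real_pos[of "1 / 2" "- w"] powr_of_real_pos[of 2 w] by (simp add: ln_div)
      then show ?thesis
        using powr_mult_of_real_pos[of x "1 / 2" "- w"] x by simp
    qed
    also have "of_real x * f x * (of_real x powr (- w) * of_real 2 powr w * of_real z powr w * Bessel_K w (x * z)) =
        (of_real 2 powr w * of_real z powr w) * ((of_real x * of_real x powr (- w)) * Bessel_K w (x * z) * f x)"
      by (simp only: mult_ac)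
    also have "of_real x * complex_of_real x powr (- w) = of_real x powr (1 - w)"
      using x by (simp add: powr_diff powr_minus divide_inverse)
    also have "complex_of_real 2 powr w * of_real z powr w = of_real (2 * z) powr w"
      using z by (intro powr_mult_of_real_pos[symmetric]) auto
    finally show ?thesis .
  qed
  have "L2_transform (\<lambda>y. of_real y powr (- 2 * w - 2) * L2_transform f (1 / (2 * y))) z =
      (\<integral>y. (\<integral>x. ?k y x \<partial>pos) \<partial>pos)"
    unfolding L2_transform_def integral_mult_right_zero ..
  also have "\<dots> = (\<integral>x. (\<integral>y. ?k y x \<partial>pos) \<partial>pos)"
    by (rule pos2.Fubini_integral[OF joint, symmetric])
  also have "\<dots> = (\<integral>x. of_real (2 * z) powr w * (of_real x powr (1 - w) * Bessel_K w (x * z) * f x) \<partial>pos)"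
    by (rule Bochner_Integration.integral_cong[OF refl inner])
  finally show ?thesis by simp
qed

text \<open>
  The inner formula requires an absolutely convergent integral over \<open>u\<close>. By Fubini the integrand including
  the factor \<open>f x\<close> is integrable in \<open>u\<close> for almost every \<open>x\<close>; where \<open>f x \<noteq> 0\<close> the factor can be
  removed, and where \<open>f x = 0\<close> both sides vanish.
\<close>

lemma Hankel_P2_transform_eq:
  assumes \<mu>: "-1 < Re \<mu>" and \<nu>: "0 < Re \<nu>" and z: "0 < z"
    and f [measurable]: "f \<in> borel_measurable pos"
    and conv: "abs_convergent_iterated (\<lambda>u x.
           of_real (sqrt (u * z)) * Bessel_J \<mu> (u * z) * (of_real u powr (\<mu> + 1 / 2) *
             (of_real x * f x / of_real (x\<^sup>2 + u\<^sup>2) powr \<nu>)))"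
  shows "Hankel_transform \<mu> (\<lambda>u. of_real u powr (\<mu> + 1 / 2) * P2_transform \<nu> f u) z =
    of_real (sqrt z) * rGamma \<nu> * of_real (z / 2) powr (\<nu> - 1) *
      (\<integral>x. of_real x powr (\<mu> + 2 - \<nu>) * Bessel_K (\<nu> - \<mu> - 1) (x * z) * f x \<partial>pos)"
proof -
  let ?k = "\<lambda>u x. of_real (sqrt (u * z)) * Bessel_J \<mu> (u * z) * (of_real u powr (\<mu> + 1 / 2) *
      (of_real x * f x / of_real (x\<^sup>2 + u\<^sup>2) powr \<nu>))"
  let ?C = "of_real (sqrt z) * rGamma \<nu> * of_real (z / 2) powr (\<nu> - 1)"
  let ?r = "\<lambda>x. of_real x powr (\<mu> + 2 - \<nu>) * Bessel_K (\<nu> - \<mu> - 1) (x * z) * f x"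
  note [measurable] = borel_measurable_Bessel_K_scaled[OF z]
  have joint: "integrable (pos \<Otimes>\<^sub>M pos) (\<lambda>(u, x). ?k u x)"
    by (rule integrable_of_abs_convergent_iterated[OF _ conv]) (simp add: case_prod_beta' del: of_real_add)
  have inner: "(\<integral>u. ?k u x \<partial>pos) = ?C * ?r x" if x: "0 < x" and int: "integrable pos (\<lambda>u. ?k u x)" for x
  proof (cases "f x = 0")
    case False
    let ?b = "\<lambda>u. Bessel_J \<mu> (u * z) * of_real u powr (\<mu> + 1) / of_real (x\<^sup>2 + u\<^sup>2) powr \<nu>"
    have k: "?k u x = (of_real (sqrt z) * of_real x * f x) * ?b u" if "u \<in> space pos" for u
    proof -
      have u: "0 < u" using that by simp
      have "complex_of_real (sqrt u) = of_real u powr (1 / 2)"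
        using u powr_of_real[of u "1/2"] by (simp add: powr_half_sqrt)
      then have "of_real (sqrt u) * of_real u powr (\<mu> + 1 / 2) = complex_of_real u powr (\<mu> + 1)"
        by (simp add: powr_add[symmetric] algebra_simps)
      then show ?thesis
        by (simp add: real_sqrt_mult mult_ac)
    qed
    have nz: "of_real (sqrt z) * of_real x * f x \<noteq> 0" using x z False by simp
    have "integrable pos (\<lambda>u. (of_real (sqrt z) * of_real x * f x) * ?b u)"
      using int by (subst (asm) Bochner_Integration.integrable_cong[OF refl k]) auto
    then have "integrable pos ?b"
      by (subst (asm) integrable_complex_mult_iff[OF nz])
    have "(\<integral>u. ?k u x \<partial>pos) = (\<integral>u. (of_real (sqrt z) * of_real x * f x) * ?b u \<partial>pos)"
      by (rule Bochner_Integration.integral_cong[OF refl k])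
    also have "\<dots> = of_real (sqrt z) * of_real x * f x * (rGamma \<nu> * of_real (z / 2) powr (\<nu> - 1) *
        of_real x powr (\<mu> + 1 - \<nu>) * Bessel_K (\<nu> - \<mu> - 1) (x * z))"
      unfolding integral_mult_right_zero integral_Bessel_J_powr[OF \<mu> \<nu> x z \<open>integrable pos ?b\<close>] ..
    also have "\<dots> = ?C * ((of_real x * of_real x powr (\<mu> + 1 - \<nu>)) * Bessel_K (\<nu> - \<mu> - 1) (x * z) * f x)"
      by (simp only: mult_ac)
    also have "of_real x * complex_of_real x powr (\<mu> + 1 - \<nu>) = of_real x powr (\<mu> + 2 - \<nu>)"
      using x by (simp add: powr_diff powr_add power2_eq_square)
    finally show ?thesis .
  qed simp
  have "Hankel_transform \<mu> (\<lambda>u. of_real u powr (\<mu> + 1 / 2) * P2_transform \<nu> f u) z =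
      (\<integral>u. (\<integral>x. ?k u x \<partial>pos) \<partial>pos)"
    unfolding Hankel_transform_def P2_transform_def integral_mult_right_zero ..
  also have "\<dots> = (\<integral>x. (\<integral>u. ?k u x \<partial>pos) \<partial>pos)"
    by (rule pos2.Fubini_integral[OF joint, symmetric])
  also have "\<dots> = (\<integral>x. ?C * ?r x \<partial>pos)"
  proof (rule integral_cong_AE)
    have "AE x in pos. integrable pos (\<lambda>u. ?k u x)"
      using pos2.AE_integrable_snd[OF joint] by simp
    with AE_space show "AE x in pos. (\<integral>u. ?k u x \<partial>pos) = ?C * ?r x"
      by eventually_elim (use inner in simp)
    show "(\<lambda>x. \<integral>u. ?k u x \<partial>pos) \<in> borel_measurable pos"
      using pos2.integrable_snd[OF joint] by simp
  qed measurable
  finally show ?thesis by simp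
qed

theorem corollary9:
  fixes \<mu> \<nu> :: complex and z :: real and f :: "real \<Rightarrow> complex"
  assumes "-1 < Re \<mu>" and "Re \<mu> < Re (2 * \<nu> - 1 / 2)" and "0 < Re \<nu>" and "0 < z"
    and "f \<in> borel_measurable (lebesgue_on {0<..})"
    and "abs_convergent_iterated (\<lambda>y x.
           of_real (y * exp (- (y\<^sup>2 * z\<^sup>2))) * (of_real y powr (2 * \<mu> - 2 * \<nu>) *
             (of_real (x * exp (- (x\<^sup>2 * (1 / (2 * y))\<^sup>2))) * f x)))"
    and "abs_convergent_iterated (\<lambda>u x.
           of_real (sqrt (u * z)) * Bessel_J \<mu> (u * z) * (of_real u powr (\<mu> + 1 / 2) *
             (of_real x * f x / of_real (x\<^sup>2 + u\<^sup>2) powr \<nu>)))"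
    and "abs_convergent (\<lambda>x.
           of_real (sqrt (x * z)) * Bessel_K (\<nu> - \<mu> - 1) (x * z) *
             (of_real x powr (\<mu> - \<nu> + 3 / 2) * f x))"
  shows
    "L2_transform (\<lambda>y. of_real y powr (2 * \<mu> - 2 * \<nu>) * L2_transform f (1 / (2 * y))) z =
       of_real z powr (\<nu> - \<mu> - 3 / 2) / 2 powr (\<mu> - \<nu> + 1) *
       K_transform (\<nu> - \<mu> - 1) (\<lambda>x. of_real x powr (\<mu> - \<nu> + 3 / 2) * f x) z
     \<and>
     L2_transform (\<lambda>y. of_real y powr (2 * \<mu> - 2 * \<nu>) * L2_transform f (1 / (2 * y))) z =
       2 powr (2 * \<nu> - \<mu> - 2) / of_real z powr (\<mu> + 1 / 2) * Gamma \<nu> *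
       Hankel_transform \<mu> (\<lambda>u. of_real u powr (\<mu> + 1 / 2) * P2_transform \<nu> f u) z
     \<and>
     Hankel_transform \<mu> (\<lambda>u. of_real u powr (\<mu> + 1 / 2) * P2_transform \<nu> f u) z =
       1 / Gamma \<nu> * of_real (z / 2) powr (\<nu> - 1) *
       K_transform (\<nu> - \<mu> - 1) (\<lambda>x. of_real x powr (\<mu> - \<nu> + 3 / 2) * f x) z"
proof -
  define w where "w = \<nu> - \<mu> - 1"
  define N where "N = (\<integral>x. of_real x powr (1 - w) * Bessel_K w (x * z) * f x \<partial>pos)"
  have expo: "2 * \<mu> - 2 * \<nu> = - 2 * w - 2" "\<mu> + 2 - \<nu> = 1 - w" "\<mu> - \<nu> + 3 / 2 = 1 / 2 - w"
      "\<nu> - \<mu> - 3 / 2 = w - 1 / 2" "\<mu> - \<nu> + 1 = - w"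
    by (simp_all add: w_def field_simps)
  have sqrt_powr: "complex_of_real (sqrt x) = of_real x powr (1 / 2)" if "0 < x" for x
    using that powr_of_real[of x "1/2"] by (simp add: powr_half_sqrt)
  have K: "K_transform w (\<lambda>x. of_real x powr (1 / 2 - w) * f x) z = of_real (sqrt z) * N"
  proof -
    have "of_real (sqrt (x * z)) * Bessel_K w (x * z) * (of_real x powr (1 / 2 - w) * f x) =
        of_real (sqrt z) * (of_real x powr (1 - w) * Bessel_K w (x * z) * f x)" if "x \<in> space pos" for x
    proof -
      have "of_real (sqrt x) * of_real x powr (1 / 2 - w) = complex_of_real x powr (1 - w)"
        using that by (simp add: sqrt_powr powr_add[symmetric])
      then show ?thesis by (simp add: real_sqrt_mult mult_ac)
    qed
    then show ?thesis
      unfolding K_transform_def N_def integral_mult_right_zero[symmetric]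
      by (intro Bochner_Integration.integral_cong) auto
  qed
  have L: "L2_transform (\<lambda>y. of_real y powr (- 2 * w - 2) * L2_transform f (1 / (2 * y))) z =
      of_real (2 * z) powr w * N"
    unfolding N_def using assms by (intro L2_L2_transform_eq) (simp_all only: expo)
  have H: "Hankel_transform \<mu> (\<lambda>u. of_real u powr (\<mu> + 1 / 2) * P2_transform \<nu> f u) z =
      of_real (sqrt z) * rGamma \<nu> * of_real (z / 2) powr (\<nu> - 1) * N"
    using Hankel_P2_transform_eq[OF assms(1,3,4,5,7)] unfolding N_def w_def[symmetric] expo(2) .
  have z: "0 < z" by (rule assms)
  have G: "rGamma \<nu> = 1 / Gamma \<nu>" "Gamma \<nu> \<noteq> 0"
    using assms(3) by (auto simp: rGamma_inverse_Gamma divide_inverse Gamma_eq_zero_iff elim!: nonpos_Ints_cases)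
  have two: "2 = complex_of_real 2" by simp
  have base: "complex_of_real (2 * z) powr w = of_real z powr (w - 1 / 2) / 2 powr (- w) * of_real (sqrt z)"
    using z unfolding sqrt_powr[OF z]
    by (simp only: two powr_of_real_pos) (simp add: powr_of_real_pos ln_mult exp_add[symmetric] exp_diff[symmetric] algebra_simps)
  have base2: "complex_of_real (2 * z) powr w =
      2 powr (2 * \<nu> - \<mu> - 2) / of_real z powr (\<mu> + 1 / 2) * (of_real (sqrt z) * of_real (z / 2) powr (\<nu> - 1))"
    using z unfolding sqrt_powr[OF z]
    by (simp only: two powr_of_real_pos) (simp add: powr_of_real_pos ln_mult ln_div w_def exp_add[symmetric] exp_diff[symmetric] algebra_simps)
  show ?thesis
    unfolding expo(1,3-5) w_def[symmetric] L H K G(1)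
  proof (intro conjI)
    show "of_real (2 * z) powr w * N = of_real z powr (w - 1 / 2) / 2 powr (- w) * (of_real (sqrt z) * N)"
      unfolding base by (simp only: mult.assoc)
    show "of_real (2 * z) powr w * N = 2 powr (2 * \<nu> - \<mu> - 2) / of_real z powr (\<mu> + 1 / 2) * Gamma \<nu> *
        (of_real (sqrt z) * (1 / Gamma \<nu>) * of_real (z / 2) powr (\<nu> - 1) * N)"
      unfolding base2 using G(2) by simp
  qed simp
qed

end
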